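(* Let $\mathbb{F}$ be a field and let $$\mathcal{L}(\lambda)=\begin{bmatrix} M(\lambda) & K_2(\lambda)^T\\ K_1(\lambda) & 0\end{bmatrix}$$ be a strong block minimal bases pencil over $\mathbb{F}$. Let $N_1(\lambda)$ be a minimal basis dual to $K_1(\lambda)$, let $N_2(\lambda)$ be a minimal basis dual to $K_2(\lambda)$, and let $Q(\lambda):=N_2(\lambda)M(\lambda)N_1(\lambda)^T$. Then the following hold: (a) If $0\le\varepsilon_1\le\varepsilon_2\le\cdots\le\varepsilon_p$ are the right minimal indices of $Q(\lambda)$, then $$\varepsilon_1+\deg(N_1(\lambda))\le\varepsilon_2+\deg(N_1(\lambda))\le\cdots\le\varepsilon_p+\deg(N_1(\lambda))$$ are the right minimal indices of $\mathcal{L}(\lambda)$. (b) If $0\le\eta_1\le\eta_2\le\cdots\le\eta_q$ are the left minimal indices of $Q(\lambda)$, then $$\eta_1+\deg(N_2(\lambda))\le\eta_2+\deg(N_2(\lambda))\le\cdots\le\eta_q+\deg(N_2(\lambda))$$ are the left minimal indices of $\mathcal{L}(\lambda)$.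
   Context: Matrix polynomials have entries in $\mathbb{F}[\lambda]$; a matrix pencil is a matrix polynomial of the form $A+\lambda B$; $\deg$ denotes the degree (largest power of $\lambda$ with nonzero coefficient). For a rational subspace $\mathcal{V}$ (a subspace over $\mathbb{F}(\lambda)$ of tuples of rational functions), a minimal basis of $\mathcal{V}$ is a basis consisting of vector polynomials whose sum of degrees is least among all polynomial bases of $\mathcal{V}$; the ordered list of degrees of its vectors is the same for all minimal bases and is called the list of minimal indices of $\mathcal{V}$. The right (resp. left) minimal indices of an $m\times n$ matrix polynomial $P(\lambda)$ are those of $\mathcal{N}_r(P)=\{x(\lambda)\in\mathbb{F}(\lambda)^{n\times 1}:P(\lambda)x(\lambda)=0\}$ (resp. $\mathcal{N}_\ell(P)=\{y(\lambda)^T\in\mathbb{F}(\lambda)^{1\times m}:y(\lambda)^TP(\lambda)=0\}$). A matrix polynomial (with fewer rows than columns) is called a minimal basis if its rows form a minimal basis of the rational subspace they span. Two matrix polynomials $L(\lambda)\in\mathbb{F}[\lambda]^{m_1\times n}$, $N(\lambda)\in\mathbb{F}[\lambda]^{m_2\times n}$ are dual minimal bases (each is "a minimal basis dual to" the other) if both are minimal bases, $m_1+m_2=n$, and $L(\lambda)N(\lambda)^T=0$. The degree of a row is the maximum degree of its entries. A pencil $\mathcal{L}(\lambda)=\begin{bmatrix} M(\lambda) & K_2(\lambda)^T\\ K_1(\lambda) & 0\end{bmatrix}$ is a strong block minimal bases pencil if $K_1(\lambda)$ and $K_2(\lambda)$ are both minimal bases, all row degrees of $K_1(\lambda)$ equal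 $1$, all row degrees of $K_2(\lambda)$ equal $1$, all row degrees of a minimal basis dual to $K_1(\lambda)$ are equal to each other, and all row degrees of a minimal basis dual to $K_2(\lambda)$ are equal to each other. The cases where $K_1$ or $K_2$ is empty are allowed: if $K_1$ (resp. $K_2$) is empty, then $N_1=I_s$ (resp. $N_2=I_s$), where $s$ is the number of columns (resp. rows) of $M(\lambda)$. *)

theory Defs
  imports "Jordan_Normal_Form.Matrix_Kernel" "HOL-Computational_Algebra.Polynomial_Factorial"
begin

definition rat_vec :: "'a::field poly vec \<Rightarrow> 'a poly fract vec" where
  "rat_vec = map_vec to_fract"

definition rat_mat :: "'a::field poly mat \<Rightarrow> 'a poly fract mat" where
  "rat_mat = map_mat to_fract"

definition rat_span :: "nat \<Rightarrow> 'a::field poly fract vec set \<Rightarrow> 'a poly fract vec set" where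
  "rat_span n S = LinearCombinations.module.span class_ring (module_vec TYPE('a poly fract) n) S"

definition rat_lin_indep :: "nat \<Rightarrow> 'a::field poly fract vec set \<Rightarrow> bool" where
  "rat_lin_indep n S \<longleftrightarrow>
     \<not> LinearCombinations.module.lin_dep class_ring (module_vec TYPE('a poly fract) n) S"

text \<open>The value 0 for a vector or matrix without nonzero entries is a convention; the vectors of
  a basis are nonzero.\<close>

definition vec_degree :: "'a::zero poly vec \<Rightarrow> nat" where
  "vec_degree v = Max (insert 0 ((\<lambda>i. degree (v $ i)) ` {..<dim_vec v}))"

definition mat_degree :: "'a::zero poly mat \<Rightarrow> nat" where
  "mat_degree P = Max (insert 0 ((\<lambda>(i, j). degree (P $$ (i, j))) ` ({..<dim_row P} \<times> {..<dim_col P})))"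

definition matrix_pencil :: "'a::field poly mat \<Rightarrow> bool" where
  "matrix_pencil P \<longleftrightarrow>
     (\<exists>A \<in> carrier_mat (dim_row P) (dim_col P). \<exists>B \<in> carrier_mat (dim_row P) (dim_col P).
        P = map_mat (\<lambda>a. [:a:]) A + [:0, 1:] \<cdot>\<^sub>m map_mat (\<lambda>b. [:b:]) B)"

definition polynomial_basis ::
  "nat \<Rightarrow> 'a::field poly fract vec set \<Rightarrow> 'a poly vec list \<Rightarrow> bool" where
  "polynomial_basis n V vs \<longleftrightarrow>
     set vs \<subseteq> carrier_vec n \<and> distinct vs \<and>
     rat_lin_indep n (rat_vec ` set vs) \<and> rat_span n (rat_vec ` set vs) = V"

definition minimal_basis_of ::
  "nat \<Rightarrow> 'a::field poly fract vec set \<Rightarrow> 'a poly vec list \<Rightarrow> bool" where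
  "minimal_basis_of n V vs \<longleftrightarrow>
     polynomial_basis n V vs \<and>
     (\<forall>ws. polynomial_basis n V ws \<longrightarrow>
        sum_list (map vec_degree vs) \<le> sum_list (map vec_degree ws))"

text \<open>Every rational subspace has a minimal basis, and all its minimal bases have the same
  ordered list of degrees, so the choice below is immaterial.\<close>

definition minimal_indices :: "nat \<Rightarrow> 'a::field poly fract vec set \<Rightarrow> nat list" where
  "minimal_indices n V = sort (map vec_degree (SOME vs. minimal_basis_of n V vs))"

definition right_null_space :: "'a::field poly mat \<Rightarrow> 'a poly fract vec set" where
  "right_null_space P = mat_kernel (rat_mat P)"

definition left_null_space :: "'a::field poly mat \<Rightarrow> 'a poly fract vec set" where
  "left_null_space P =
     {y \<in> carrier_vec (dim_row P). mat_of_row y * rat_mat P = 0\<^sub>m 1 (dim_col P)}"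

definition right_minimal_indices :: "'a::field poly mat \<Rightarrow> nat list" where
  "right_minimal_indices P = minimal_indices (dim_col P) (right_null_space P)"

definition left_minimal_indices :: "'a::field poly mat \<Rightarrow> nat list" where
  "left_minimal_indices P = minimal_indices (dim_row P) (left_null_space P)"

text \<open>A matrix with no rows and at least one column is a minimal basis of the zero subspace.\<close>

definition minimal_basis :: "'a::field poly mat \<Rightarrow> bool" where
  "minimal_basis P \<longleftrightarrow>
     dim_row P < dim_col P \<and>
     minimal_basis_of (dim_col P) (rat_span (dim_col P) (rat_vec ` set (rows P))) (rows P)"

definition dual_minimal_bases :: "'a::field poly mat \<Rightarrow> 'a poly mat \<Rightarrow> bool" where
  "dual_minimal_bases L N \<longleftrightarrow>
     minimal_basis L \<and> minimal_basis N \<and> dim_col N = dim_col L \<and>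
     dim_row L + dim_row N = dim_col L \<and> L * N\<^sup>T = 0\<^sub>m (dim_row L) (dim_row N)"

text \<open>For an empty \<open>K\<close> the dual is by convention the identity matrix, which has as many rows as
  columns and hence is not covered by \<^const>\<open>dual_minimal_bases\<close>.\<close>

definition minimal_basis_dual_to :: "'a::field poly mat \<Rightarrow> 'a poly mat \<Rightarrow> bool" where
  "minimal_basis_dual_to K N \<longleftrightarrow>
     (if dim_row K = 0 then N = 1\<^sub>m (dim_col K) else dual_minimal_bases K N)"

definition block_pencil ::
  "'a::field poly mat \<Rightarrow> 'a poly mat \<Rightarrow> 'a poly mat \<Rightarrow> 'a poly mat" where
  "block_pencil M K1 K2 = four_block_mat M K2\<^sup>T K1 (0\<^sub>m (dim_row K1) (dim_row K2))"

definition strong_minimal_block :: "'a::field poly mat \<Rightarrow> bool" where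
  "strong_minimal_block K \<longleftrightarrow>
     minimal_basis K \<and>
     (\<forall>v \<in> set (rows K). vec_degree v = 1) \<and>
     (\<exists>N. minimal_basis_dual_to K N \<and>
        (\<forall>v \<in> set (rows N). \<forall>w \<in> set (rows N). vec_degree v = vec_degree w))"

definition strong_block_minimal_bases_pencil ::
  "'a::field poly mat \<Rightarrow> 'a poly mat \<Rightarrow> 'a poly mat \<Rightarrow> bool" where
  "strong_block_minimal_bases_pencil M K1 K2 \<longleftrightarrow>
     dim_col K1 = dim_col M \<and> dim_col K2 = dim_row M \<and>
     matrix_pencil (block_pencil M K1 K2) \<and>
     strong_minimal_block K1 \<and> strong_minimal_block K2"

end

theory Submission
  imports Defs
begin

text \<open>
  Over \<open>F[\<lambda>]\<close>, a minimal basis of a rational subspace has two properties, both because a violation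
  would allow a basis vector to be replaced by one of smaller degree: every polynomial vector of the
  subspace is a polynomial combination of the basis, and the degree of such a combination is the
  maximum of the degrees of its terms. They make the list of degrees unique: the number of basis
  vectors of degree at most \<open>t\<close> is the rank of the polynomial vectors of degree at most \<open>t\<close>.

  Let \<open>X\<close> be the module of polynomial vectors \<open>x\<close> with \<open>K1 x = 0\<close> and \<open>N2 M x = 0\<close>. The map
  \<open>z \<mapsto> N1\<^sup>T z\<close> is a bijection from the kernel of \<open>Q\<close> onto \<open>X\<close> and raises degrees by \<open>deg N1\<close>, since
  all rows of \<open>N1\<close> have this degree. The projection \<open>(x, y) \<mapsto> x\<close> is a bijection from the kernel of
  the block pencil onto \<open>X\<close>, since the rows of \<open>K2\<close> form a minimal basis of the kernel of \<open>N2\<close>, and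
  preserves degrees, since \<open>K2\<^sup>T y = - M x\<close> gives \<open>deg y + 1 \<le> deg x + 1\<close>. Such bijections map
  minimal bases to minimal bases. The left minimal indices follow by transposition.
\<close>

section \<open>Free lists and saturated modules over a domain\<close>

text \<open>Linear independence for lists, encoded as a trivial kernel of the matrix of columns.
  With lists, a repeated vector counts as a dependence and coefficients are indexed by
  position.\<close>

definition free_list :: "nat \<Rightarrow> 'b::idom vec list \<Rightarrow> bool" where
  "free_list n vs \<longleftrightarrow> set vs \<subseteq> carrier_vec n \<and>
     (\<forall>c \<in> carrier_vec (length vs). mat_of_cols n vs *\<^sub>v c = 0\<^sub>v n \<longrightarrow> c = 0\<^sub>v (length vs))"

text \<open>Working with a denominator \<open>q\<close> keeps everything over the domain: \<open>sat_span\<close> is the set of vectors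
  over the domain that lie in the span over its field of fractions.\<close>

definition sat_span :: "nat \<Rightarrow> 'b::idom vec list \<Rightarrow> 'b vec set" where
  "sat_span n vs = {u \<in> carrier_vec n. \<exists>q c. q \<noteq> 0 \<and> c \<in> carrier_vec (length vs) \<and>
     q \<cdot>\<^sub>v u = mat_of_cols n vs *\<^sub>v c}"

text \<open>Submodules closed under division by nonzero scalars. Over polynomials these are the sets
  of polynomial vectors in rational subspaces, over a field just the subspaces, so one notion serves
  both rings.\<close>

definition saturated :: "nat \<Rightarrow> 'b::idom vec set \<Rightarrow> bool" where
  "saturated n W \<longleftrightarrow> W \<subseteq> carrier_vec n \<and> 0\<^sub>v n \<in> W \<and> (\<forall>u \<in> W. \<forall>v \<in> W. u + v \<in> W) \<and>
     (\<forall>a. \<forall>u \<in> W. a \<cdot>\<^sub>v u \<in> W) \<and> (\<forall>q. \<forall>u \<in> carrier_vec n. q \<noteq> 0 \<longrightarrow> q \<cdot>\<^sub>v u \<in> W \<longrightarrow> u \<in> W)"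

section \<open>Linear combinations as products with a matrix of columns\<close>

lemma mat_of_cols_mult_vec_index:
  fixes c :: "'b::comm_ring_1 vec"
  assumes "i < n" "c \<in> carrier_vec (length vs)"
  shows "(mat_of_cols n vs *\<^sub>v c) $ i = (\<Sum>j<length vs. vs ! j $ i * c $ j)"
  using assms by (auto simp: scalar_prod_def mat_of_cols_index atLeast0LessThan)

lemma mat_of_cols_mult_vec_carrier [simp]: "mat_of_cols n vs *\<^sub>v c \<in> carrier_vec n"
  unfolding carrier_vec_def by simp

lemma mat_of_cols_snoc_mult_vec:
  fixes c :: "'b::comm_ring_1 vec"
  assumes "c \<in> carrier_vec (Suc (length vs))" "x \<in> carrier_vec n"
  shows "mat_of_cols n (vs @ [x]) *\<^sub>v c
    = mat_of_cols n vs *\<^sub>v vec (length vs) (($) c) + c $ length vs \<cdot>\<^sub>v x"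
  using assms
  by (intro eq_vecI)
     (auto simp: mat_of_cols_mult_vec_index nth_append mult.commute simp del: index_mult_mat_vec intro!: sum.cong)

lemma vec_smult_zero: "x \<in> carrier_vec n \<Longrightarrow> 0 \<cdot>\<^sub>v x = (0\<^sub>v n :: 'b::comm_ring_1 vec)"
  by (intro eq_vecI) auto

lemma smult_zero_vec [simp]: "q \<cdot>\<^sub>v 0\<^sub>v n = (0\<^sub>v n :: 'b::comm_ring_1 vec)"
  by (intro eq_vecI) auto

lemma mat_vec_smult:
  fixes A :: "'b::comm_ring_1 mat"
  assumes "A \<in> carrier_mat m n" "v \<in> carrier_vec n"
  shows "A *\<^sub>v (q \<cdot>\<^sub>v v) = q \<cdot>\<^sub>v (A *\<^sub>v v)"
  using assms by (intro eq_vecI) auto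

text \<open>Zero rows pad \<open>A\<close> to a square matrix, which is then singular; over a domain
  a singular matrix annihilates some nonzero vector.\<close>

lemma wide_matrix_kernel:
  fixes A :: "'b::idom mat"
  assumes A: "A \<in> carrier_mat l k" and lk: "l < k"
  obtains v where "v \<in> carrier_vec k" "v \<noteq> 0\<^sub>v k" "A *\<^sub>v v = 0\<^sub>v l"
proof -
  define B where "B = mat\<^sub>r k k (\<lambda>i. if i = l then 0\<^sub>v k else if i < l then row A i else 0\<^sub>v k)"
  have B: "B \<in> carrier_mat k k" by (simp add: B_def)
  \<comment> \<open>Row \<open>l\<close> of \<open>B\<close> exists because \<open>l < k\<close>,
    and it is zero.\<close>
  have "det B = 0" unfolding B_def
    using A by (intro det_row_0 lk) (auto intro: carrier_vecI)
  then obtain v where v: "v \<in> carrier_vec k" "v \<noteq> 0\<^sub>v k" "B *\<^sub>v v = 0\<^sub>v k"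
    using det_0_iff_vec_prod_zero[OF B] by auto
  have "A *\<^sub>v v = 0\<^sub>v l"
  proof (intro eq_vecI)
    fix i assume i: "i < dim_vec (0\<^sub>v l :: 'b vec)"
    have "row B i = row A i" using i lk A by (auto simp: B_def)
    moreover have "(B *\<^sub>v v) $ i = 0" using v(3) i lk by simp
    ultimately show "(A *\<^sub>v v) $ i = 0\<^sub>v l $ i" using i lk A B by auto
  qed (use A in auto)
  with v that show thesis by blast
qed

text \<open>In a dependence, a nonzero coefficient of \<open>x\<close> would itself be a denominator
  that puts \<open>x\<close> into the span of \<open>vs\<close>. So this coefficient vanishes and
  the freeness of \<open>vs\<close> does the rest.\<close>

lemma free_list_snoc:
  assumes vs: "free_list n vs" and x: "x \<in> carrier_vec n" "x \<notin> sat_span n vs"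
  shows "free_list n (vs @ [x])"
proof -
  let ?k = "length vs"
  have "c = 0\<^sub>v (Suc ?k)" if c: "c \<in> carrier_vec (Suc ?k)"
    and eq: "mat_of_cols n (vs @ [x]) *\<^sub>v c = 0\<^sub>v n" for c
  proof -
    let ?c = "vec ?k (($) c)"
    have e: "mat_of_cols n vs *\<^sub>v ?c + c $ ?k \<cdot>\<^sub>v x = 0\<^sub>v n"
      using eq mat_of_cols_snoc_mult_vec[OF c x(1)] by simp
    have c0: "c $ ?k = 0"
    proof (rule ccontr)
      assume nz: "c $ ?k \<noteq> 0"
      have "c $ ?k \<cdot>\<^sub>v x = mat_of_cols n vs *\<^sub>v (- ?c)"
      proof (intro eq_vecI)
        fix i assume "i < dim_vec (mat_of_cols n vs *\<^sub>v (- ?c))"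
        then have i: "i < n" by simp
        have "(mat_of_cols n vs *\<^sub>v ?c + c $ ?k \<cdot>\<^sub>v x) $ i = 0" using e i by simp
        then have "(mat_of_cols n vs *\<^sub>v ?c) $ i + c $ ?k * x $ i = 0"
          using i x by (simp del: index_mult_mat_vec)
        then show "(c $ ?k \<cdot>\<^sub>v x) $ i = (mat_of_cols n vs *\<^sub>v (- ?c)) $ i"
          using i x by (simp add: mat_of_cols_mult_vec_index sum_negf add_eq_0_iff del: index_mult_mat_vec)
      qed (use x in simp)
      then have "x \<in> sat_span n vs" unfolding sat_span_def using x(1) nz
        by (auto intro!: exI[of _ "c $ ?k"] exI[of _ "- ?c"])
      with x show False by simp
    qed
    then have "mat_of_cols n vs *\<^sub>v ?c = 0\<^sub>v n" using e x(1)
      by (metis mat_of_cols_mult_vec_carrier right_zero_vec vec_smult_zero)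
    then have "?c = 0\<^sub>v ?k" using vs unfolding free_list_def by auto
    then have "c $ j = 0" if "j < Suc ?k" for j
      using c0 that by (cases "j = ?k") (auto dest!: arg_cong[where f = "\<lambda>v. v $ j"])
    then show ?thesis using c by (intro eq_vecI) auto
  qed
  then show ?thesis using vs x(1) by (auto simp: free_list_def)
qed

lemma free_list_Nil [simp]: "free_list n []"
  by (auto simp: free_list_def)

lemma mult_mat_of_cols:
  assumes "B \<in> carrier_mat m n" "set vs \<subseteq> carrier_vec n"
  shows "B * mat_of_cols n vs = mat_of_cols m (map ((*\<^sub>v) B) vs)"
  using assms by (intro eq_matI) (auto simp: mat_of_cols_index col_mat_of_cols subsetD[OF _ nth_mem])

lemma mult_mat_of_cols_vec:
  fixes B :: "'b::comm_ring_1 mat"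
  assumes "B \<in> carrier_mat m n" "set vs \<subseteq> carrier_vec n" "c \<in> carrier_vec (length vs)"
  shows "B *\<^sub>v (mat_of_cols n vs *\<^sub>v c) = mat_of_cols m (map ((*\<^sub>v) B) vs) *\<^sub>v c"
  using assms by (subst assoc_mult_mat_vec[symmetric, where n\<^sub>2 = n and n\<^sub>3 = "length vs"])
    (auto simp: mult_mat_of_cols)

text \<open>Steinitz bound: if \<open>us\<close> were longer, the matrix \<open>C\<close> of its
  coefficients with respect to \<open>bs\<close> would have more columns than rows, and a kernel
  vector of \<open>C\<close> would give a dependence in \<open>us\<close>.\<close>

lemma free_list_length_le_spanning:
  assumes us: "free_list n us" and sub: "set us \<subseteq> sat_span n bs"
  shows "length us \<le> length bs"
proof (rule ccontr)
  let ?k = "length us" and ?l = "length bs"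
  assume "\<not> ?k \<le> ?l"
  then have lk: "?l < ?k" by simp
  have "\<forall>i<?k. \<exists>q c. q \<noteq> 0 \<and> c \<in> carrier_vec ?l \<and> q \<cdot>\<^sub>v us ! i = mat_of_cols n bs *\<^sub>v c"
    using sub nth_mem unfolding sat_span_def by blast
  then obtain q c where qc: "\<And>i. i < ?k \<Longrightarrow> q i \<noteq> 0 \<and> c i \<in> carrier_vec ?l \<and>
      q i \<cdot>\<^sub>v us ! i = mat_of_cols n bs *\<^sub>v c i" by metis
  define C where "C = mat_of_cols ?l (map c [0..<?k])"
  have C: "C \<in> carrier_mat ?l ?k" by (auto simp: C_def carrier_matI)
  from wide_matrix_kernel[OF C lk] obtain v where
    v: "v \<in> carrier_vec ?k" "v \<noteq> 0\<^sub>v ?k" "C *\<^sub>v v = 0\<^sub>v ?l" .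
  \<comment> \<open>The columns of \<open>C\<close> express
    \<open>q i \<cdot>\<^sub>v us ! i\<close> rather than \<open>us ! i\<close>, so the kernel
    vector is rescaled by the denominators.\<close>
  let ?w = "vec ?k (\<lambda>i. q i * v $ i)"
  have "mat_of_cols n us *\<^sub>v ?w = mat_of_cols n bs *\<^sub>v (C *\<^sub>v v)"
  proof -
    have "mat_of_cols n bs *\<^sub>v (C *\<^sub>v v)
      = mat_of_cols n (map ((*\<^sub>v) (mat_of_cols n bs)) (map c [0..<?k])) *\<^sub>v v"
      unfolding C_def using qc v(1) by (intro mult_mat_of_cols_vec) auto
    also have "\<dots> = mat_of_cols n us *\<^sub>v ?w"
    proof (intro eq_vecI)
      fix i assume "i < dim_vec (mat_of_cols n us *\<^sub>v ?w)"
      then have i: "i < n" by simp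
      have "(mat_of_cols n bs *\<^sub>v c j) $ i = q j * us ! j $ i" if "j < ?k" for j
      proof -
        have "us ! j \<in> carrier_vec n" using us that by (auto simp: free_list_def)
        then show ?thesis using qc[OF that] i by (metis index_smult_vec(1) carrier_vecD)
      qed
      then show "(mat_of_cols n (map ((*\<^sub>v) (mat_of_cols n bs)) (map c [0..<?k])) *\<^sub>v v) $ i
          = (mat_of_cols n us *\<^sub>v ?w) $ i"
        using i v(1) by (simp add: mat_of_cols_mult_vec_index algebra_simps del: index_mult_mat_vec)
    qed simp
    finally show ?thesis by simp
  qed
  also have "\<dots> = 0\<^sub>v n" using v(3) by (intro eq_vecI) (auto simp: scalar_prod_def)
  finally have "?w = 0\<^sub>v ?k" using us by (auto simp: free_list_def)
  then have "v $ i = 0" if "i < ?k" for i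
    using that qc[OF that] by (auto dest!: arg_cong[where f = "\<lambda>v. v $ i"])
  then have "v = 0\<^sub>v ?k" using v(1) by (intro eq_vecI) auto
  with v(2) show False by simp
qed

lemma carrier_vec_subset_sat_span_unit_vecs: "carrier_vec n \<subseteq> sat_span n (unit_vecs n)"
proof
  fix u :: "'b::idom vec" assume u: "u \<in> carrier_vec n"
  have "u = mat_of_cols n (unit_vecs n) *\<^sub>v u"
  proof (intro eq_vecI)
    fix i assume "i < dim_vec (mat_of_cols n (unit_vecs n) *\<^sub>v u)"
    then have i: "i < n" by simp
    have "(\<Sum>j<n. unit_vec n j $ i * u $ j) = (\<Sum>j<n. if i = j then u $ j else 0)"
      using i by (intro sum.cong) auto
    then show "u $ i = (mat_of_cols n (unit_vecs n) *\<^sub>v u) $ i"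
      using i u by (simp add: mat_of_cols_mult_vec_index unit_vecs_def del: index_mult_mat_vec)
  qed (use u in simp)
  then show "u \<in> sat_span n (unit_vecs n)" using u
    by (auto simp: sat_span_def unit_vecs_def intro!: exI[of _ 1] exI[of _ u])
qed

lemma free_list_length_le_dim: "free_list n us \<Longrightarrow> length us \<le> n"
  using free_list_length_le_spanning[of n us "unit_vecs n"] carrier_vec_subset_sat_span_unit_vecs[of n]
  by (auto simp: free_list_def unit_vecs_def)

text \<open>Lengths of free lists are bounded by \<open>n\<close>, so a longest one inside
  \<open>S\<close> exists; a vector of \<open>S\<close> outside its span could be appended to
  it.\<close>

lemma maximal_free_list:
  assumes S: "S \<subseteq> carrier_vec n"
  obtains bs where "free_list n bs" "set bs \<subseteq> S" "S \<subseteq> sat_span n bs"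
proof -
  let ?P = "\<lambda>bs. free_list n bs \<and> set bs \<subseteq> S"
  obtain bs where bs: "?P bs" and max: "\<And>cs. ?P cs \<Longrightarrow> length cs \<le> length bs"
    using ex_has_greatest_nat[of ?P "[]" length "Suc n"] free_list_length_le_dim
    by (force simp: less_Suc_eq_le)
  have "x \<in> sat_span n bs" if "x \<in> S" for x
  proof (rule ccontr)
    assume "x \<notin> sat_span n bs"
    then have "?P (bs @ [x])" using that bs S by (auto intro: free_list_snoc)
    from max[OF this] show False by simp
  qed
  with bs that show thesis by blast
qed

text \<open>Membership is asked only of vectors with nonzero coefficient. This form later restricts
  a combination to the basis vectors of bounded degree.\<close>

lemma saturated_mat_of_cols_mult_vec_support:
  assumes W: "saturated n W" and vs: "set vs \<subseteq> carrier_vec n" and c: "c \<in> carrier_vec (length vs)"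
    and supp: "\<And>j. j < length vs \<Longrightarrow> c $ j \<noteq> 0 \<Longrightarrow> vs ! j \<in> W"
  shows "mat_of_cols n vs *\<^sub>v c \<in> W"
  using vs c supp
proof (induction vs arbitrary: c rule: rev_induct)
  case Nil
  have "mat_of_cols n [] *\<^sub>v c = 0\<^sub>v n" using Nil by (intro eq_vecI) (auto simp: scalar_prod_def)
  then show ?case using W by (simp add: saturated_def)
next
  case (snoc x xs)
  have "xs ! j \<in> W" if "j < length xs" "c $ j \<noteq> 0" for j
    using snoc.prems(3)[of j] that by (auto simp: nth_append)
  then have 1: "mat_of_cols n xs *\<^sub>v vec (length xs) (($) c) \<in> W"
    using snoc.prems by (intro snoc.IH) auto
  have 2: "c $ length xs \<cdot>\<^sub>v x \<in> W"
  proof (cases "c $ length xs = 0")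
    case True
    then show ?thesis using snoc.prems(1) W by (auto simp: vec_smult_zero saturated_def)
  next
    case False
    then show ?thesis using snoc.prems(3)[of "length xs"] W by (auto simp: saturated_def)
  qed
  show ?case using 1 2 W snoc.prems by (auto simp: mat_of_cols_snoc_mult_vec saturated_def)
qed

lemma saturated_mat_of_cols_mult_vec:
  assumes "saturated n W" "set vs \<subseteq> W" "c \<in> carrier_vec (length vs)"
  shows "mat_of_cols n vs *\<^sub>v c \<in> W"
proof (rule saturated_mat_of_cols_mult_vec_support)
  show "set vs \<subseteq> carrier_vec n" using assms(1,2) by (auto simp: saturated_def)
qed (use assms in auto)

lemma saturated_sat_span_subset:
  assumes W: "saturated n W" and vs: "set vs \<subseteq> W"
  shows "sat_span n vs \<subseteq> W"
proof
  fix u assume "u \<in> sat_span n vs"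
  then obtain q c where "u \<in> carrier_vec n" "q \<noteq> 0" "c \<in> carrier_vec (length vs)"
    "q \<cdot>\<^sub>v u = mat_of_cols n vs *\<^sub>v c" by (auto simp: sat_span_def)
  then show "u \<in> W" using W saturated_mat_of_cols_mult_vec[OF assms, of c] unfolding saturated_def by metis
qed

section \<open>Kernels, saturated spans and sublists\<close>

lemma saturated_mat_kernel:
  assumes A: "A \<in> carrier_mat m n"
  shows "saturated n (mat_kernel A)"
proof -
  have "u \<in> mat_kernel A" if "q \<noteq> 0" "u \<in> carrier_vec n" "q \<cdot>\<^sub>v u \<in> mat_kernel A" for q u
  proof -
    have *: "q \<cdot>\<^sub>v (A *\<^sub>v u) = 0\<^sub>v m"
      using that A by (auto simp: mat_kernel_def mat_vec_smult[OF A])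
    have "(A *\<^sub>v u) $ i = 0" if "i < m" for i
    proof -
      have "(q \<cdot>\<^sub>v (A *\<^sub>v u)) $ i = 0" using * that by simp
      then show ?thesis using \<open>q \<noteq> 0\<close> that A by (simp del: index_mult_mat_vec)
    qed
    then have "A *\<^sub>v u = 0\<^sub>v m" using A by (intro eq_vecI) (auto simp del: index_mult_mat_vec)
    then show ?thesis using that A by (auto simp: mat_kernel_def)
  qed
  then show ?thesis using A unfolding saturated_def
    by (auto simp: mat_kernel[OF A] mult_add_distrib_mat_vec[OF A] mat_vec_smult[OF A])
qed

lemma subset_sat_span: "set vs \<subseteq> carrier_vec n \<Longrightarrow> set vs \<subseteq> sat_span n vs"
proof
  fix v assume vs: "set vs \<subseteq> carrier_vec n" and "v \<in> set vs"
  then obtain j where j: "j < length vs" "v = vs ! j" by (auto simp: in_set_conv_nth)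
  then have "v \<in> carrier_vec n" using vs by auto
  then have "mat_of_cols n vs *\<^sub>v unit_vec (length vs) j = v"
    using j by (intro eq_vecI) (auto simp: mat_of_cols_index)
  then show "v \<in> sat_span n vs" using vs \<open>v \<in> set vs\<close>
    by (auto simp: sat_span_def intro!: exI[of _ 1] exI[of _ "unit_vec (length vs) j"])
qed

lemma mat_of_cols_append_mult_vec:
  fixes c :: "'b::comm_ring_1 vec"
  assumes "c \<in> carrier_vec (length us + length vs)"
  shows "mat_of_cols n (us @ vs) *\<^sub>v c
    = mat_of_cols n us *\<^sub>v vec_first c (length us) + mat_of_cols n vs *\<^sub>v vec_last c (length vs)"
proof -
  have split: "(\<Sum>j<k + r. f j) = (\<Sum>j<k. f j) + (\<Sum>j<r. f (k + j))" for k r and f :: "nat \<Rightarrow> 'b"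
    by (induction r) (auto simp: add.assoc)
  show ?thesis using assms
    by (intro eq_vecI)
       (auto simp: mat_of_cols_mult_vec_index split nth_append vec_first_def vec_last_def simp del: index_mult_mat_vec)
qed

lemma mult_mat_vec_zero: "A *\<^sub>v 0\<^sub>v (dim_col A) = (0\<^sub>v (dim_row A) :: 'b::comm_ring_1 vec)"
  by (intro eq_vecI) (auto simp: scalar_prod_def)

lemma mat_of_cols_rows: "A \<in> carrier_mat m n \<Longrightarrow> mat_of_cols n (rows A) = A\<^sup>T"
  by (intro eq_matI) (auto simp: mat_of_cols_index)

text \<open>Lift a maximal free list of columns of \<open>K\<close>; its length is at least the number of rows, and it
  stays free together with any free list of kernel vectors.\<close>

lemma free_list_kernel_length:
  assumes K: "K \<in> carrier_mat m n" and rows: "free_list n (rows K)"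
    and us: "free_list n us" "set us \<subseteq> mat_kernel K"
  shows "length us + m \<le> n"
proof -
  let ?S = "(*\<^sub>v) K ` carrier_vec n"
  have "?S \<subseteq> carrier_vec m" using K by auto
  from maximal_free_list[OF this] obtain bs where
    bs: "free_list m bs" "set bs \<subseteq> ?S" "?S \<subseteq> sat_span m bs" .
  from bs(2) have "\<forall>b \<in> set bs. \<exists>e. b = K *\<^sub>v e \<and> e \<in> carrier_vec n" by auto
  then obtain f where f: "\<And>b. b \<in> set bs \<Longrightarrow> b = K *\<^sub>v f b \<and> f b \<in> carrier_vec n" by metis
  define es where "es = map f bs"
  have es: "set es \<subseteq> carrier_vec n" "map ((*\<^sub>v) K) es = bs" "length es = length bs"
    using f by (auto simp: es_def intro!: nth_equalityI)
  let ?k = "length us" and ?r = "length bs"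
  \<comment> \<open>If \<open>bs\<close> had fewer than \<open>m\<close> vectors, some nonzero
    \<open>y\<close> would be orthogonal to all of them, hence to all columns of \<open>K\<close>.
    This is a dependence between the rows of \<open>K\<close>.\<close>
  have "m \<le> ?r"
  proof (rule ccontr)
    assume "\<not> m \<le> ?r"
    then have "?r < m" by simp
    moreover have B: "(mat_of_cols m bs)\<^sup>T \<in> carrier_mat ?r m" by (auto intro: carrier_matI)
    ultimately obtain y where y: "y \<in> carrier_vec m" "y \<noteq> 0\<^sub>v m"
      "(mat_of_cols m bs)\<^sup>T *\<^sub>v y = 0\<^sub>v ?r" using wide_matrix_kernel by metis
    have "K\<^sup>T *\<^sub>v y = 0\<^sub>v n"
    proof (intro eq_vecI)
      fix j assume "j < dim_vec (0\<^sub>v n :: 'a vec)"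
      then have j: "j < n" by simp
      have "K *\<^sub>v unit_vec n j = col K j" using j K by (auto intro!: eq_vecI)
      then have "col K j \<in> sat_span m bs" using bs(3) by (metis image_subset_iff unit_vec_carrier)
      then obtain q c where q: "q \<noteq> 0" and c: "c \<in> carrier_vec ?r"
        and e: "q \<cdot>\<^sub>v col K j = mat_of_cols m bs *\<^sub>v c" by (auto simp: sat_span_def)
      have cK: "col K j \<in> carrier_vec m" using K by auto
      have "q * (col K j \<bullet> y) = (mat_of_cols m bs *\<^sub>v c) \<bullet> y"
        unfolding e[symmetric] using cK y by simp
      also have "\<dots> = c \<bullet> ((mat_of_cols m bs)\<^sup>T *\<^sub>v y)"
        using c y(1) transpose_vec_mult_scalar[of "mat_of_cols m bs" m ?r c y]
        by (metis B comm_scalar_prod mat_of_cols_mult_vec_carrier mult_mat_vec_carrier mat_of_cols_carrier(1))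
      also have "\<dots> = 0" using y(3) c by simp
      finally show "(K\<^sup>T *\<^sub>v y) $ j = 0\<^sub>v n $ j" using q j K by simp
    qed (use K in auto)
    with rows y K show False by (auto simp: free_list_def mat_of_cols_rows)
  qed
  \<comment> \<open>Applying \<open>K\<close> to a dependence kills the part from \<open>us\<close>
    and leaves one in \<open>bs\<close>, so the coefficients of \<open>es\<close> vanish
    first.\<close>
  moreover have "free_list n (us @ es)"
  proof -
    have "c = 0\<^sub>v (?k + ?r)" if c: "c \<in> carrier_vec (?k + ?r)"
      and eq: "mat_of_cols n (us @ es) *\<^sub>v c = 0\<^sub>v n" for c
    proof -
      define c1 c2 where "c1 = vec_first c ?k" and "c2 = vec_last c ?r"
      have cc: "c1 \<in> carrier_vec ?k" "c2 \<in> carrier_vec ?r" by (auto simp: c1_def c2_def)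
      have e: "mat_of_cols n us *\<^sub>v c1 + mat_of_cols n es *\<^sub>v c2 = 0\<^sub>v n"
        using eq c es(3) by (simp add: mat_of_cols_append_mult_vec c1_def c2_def)
      have "mat_of_cols n us *\<^sub>v c1 \<in> mat_kernel K"
        using saturated_mat_of_cols_mult_vec[OF saturated_mat_kernel[OF K] us(2)] cc by simp
      then have k0: "K *\<^sub>v (mat_of_cols n us *\<^sub>v c1) = 0\<^sub>v m" using K by (simp add: mat_kernel[OF K])
      have "0\<^sub>v m = K *\<^sub>v (mat_of_cols n us *\<^sub>v c1 + mat_of_cols n es *\<^sub>v c2)"
        using e K mult_mat_vec_zero[of K] by auto
      also have "\<dots> = 0\<^sub>v m + mat_of_cols m bs *\<^sub>v c2"
        using K cc es by (subst mult_add_distrib_mat_vec[OF K]) (auto simp: k0 mult_mat_of_cols_vec)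
      also have "\<dots> = mat_of_cols m bs *\<^sub>v c2" by (intro left_zero_vec) simp
      finally have c20: "c2 = 0\<^sub>v ?r" using bs(1) cc(2) by (auto simp: free_list_def)
      then have "mat_of_cols n es *\<^sub>v c2 = 0\<^sub>v n" using mult_mat_vec_zero[of "mat_of_cols n es"] es(3) by simp
      then have "mat_of_cols n us *\<^sub>v c1 = 0\<^sub>v n" using e
        by (metis mat_of_cols_mult_vec_carrier right_zero_vec)
      then have "c1 = 0\<^sub>v ?k" using us(1) cc(1) by (auto simp: free_list_def)
      with c20 have "c = 0\<^sub>v ?k @\<^sub>v 0\<^sub>v ?r" using vec_first_last_append[of c ?k ?r] c
        by (simp add: c1_def c2_def)
      then show ?thesis by (auto intro!: eq_vecI)
    qed
    then show ?thesis using us(1) es by (auto simp: free_list_def)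
  qed
  ultimately show ?thesis using free_list_length_le_dim[of n "us @ es"] es(3) by simp
qed

text \<open>The rows of \<open>N\<close> are \<open>l\<close> free vectors in the kernel of
  \<open>K\<close>. A kernel vector outside their span would extend them to \<open>l + 1\<close>
  free kernel vectors, more than \<open>n - m\<close>.\<close>

lemma mat_kernel_eq_sat_span_rows:
  assumes K: "K \<in> carrier_mat m n" and N: "N \<in> carrier_mat l n" and dim: "m + l = n"
    and free: "free_list n (rows K)" "free_list n (rows N)" and KN: "K * N\<^sup>T = 0\<^sub>m m l"
  shows "mat_kernel K = sat_span n (rows N)"
proof
  have sub: "set (rows N) \<subseteq> mat_kernel K"
  proof
    fix v assume "v \<in> set (rows N)"
    then obtain i where i: "i < l" "v = row N i" using N by (auto simp: rows_def)
    have "K *\<^sub>v col N\<^sup>T i = col (K * N\<^sup>T) i" using K N i by (intro eq_vecI) auto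
    then show "v \<in> mat_kernel K" using K N i by (auto simp: mat_kernel[OF K] KN)
  qed
  then show "sat_span n (rows N) \<subseteq> mat_kernel K"
    by (intro saturated_sat_span_subset saturated_mat_kernel[OF K])
  show "mat_kernel K \<subseteq> sat_span n (rows N)"
  proof
    fix x assume x: "x \<in> mat_kernel K"
    show "x \<in> sat_span n (rows N)"
    proof (rule ccontr)
      assume "x \<notin> sat_span n (rows N)"
      then have "free_list n (rows N @ [x])" using free x by (auto intro: free_list_snoc simp: mat_kernel[OF K])
      from free_list_kernel_length[OF K free(1) this] show False using x sub N dim by auto
    qed
  qed
qed

lemma saturated_sat_span: "saturated n (sat_span n vs)"
proof -
  let ?A = "mat_of_cols n vs" and ?k = "length vs"
  have A: "?A \<in> carrier_mat n ?k" by simp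
  have add: "u + v \<in> sat_span n vs" if "u \<in> sat_span n vs" "v \<in> sat_span n vs" for u v
  proof -
    from that obtain p c q d where *: "u \<in> carrier_vec n" "v \<in> carrier_vec n"
      "p \<noteq> 0" "c \<in> carrier_vec ?k" "p \<cdot>\<^sub>v u = ?A *\<^sub>v c"
      "q \<noteq> 0" "d \<in> carrier_vec ?k" "q \<cdot>\<^sub>v v = ?A *\<^sub>v d"
      by (auto simp: sat_span_def)
    have "(p * q) \<cdot>\<^sub>v (u + v) = q \<cdot>\<^sub>v (p \<cdot>\<^sub>v u) + p \<cdot>\<^sub>v (q \<cdot>\<^sub>v v)"
      using *(1,2) by (intro eq_vecI) (auto simp: algebra_simps)
    also have "\<dots> = ?A *\<^sub>v (q \<cdot>\<^sub>v c + p \<cdot>\<^sub>v d)"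
      using * by (simp add: mat_vec_smult[OF A] mult_add_distrib_mat_vec[OF A])
    finally show ?thesis using * unfolding sat_span_def
      by (auto intro!: exI[of _ "p * q"] exI[of _ "q \<cdot>\<^sub>v c + p \<cdot>\<^sub>v d"])
  qed
  have smult: "a \<cdot>\<^sub>v u \<in> sat_span n vs" if "u \<in> sat_span n vs" for a u
  proof -
    from that obtain p c where *: "u \<in> carrier_vec n"
      "p \<noteq> 0" "c \<in> carrier_vec ?k" "p \<cdot>\<^sub>v u = ?A *\<^sub>v c"
      by (auto simp: sat_span_def)
    then have "p \<cdot>\<^sub>v (a \<cdot>\<^sub>v u) = ?A *\<^sub>v (a \<cdot>\<^sub>v c)"
      by (metis mat_vec_smult[OF A] smult_smult_assoc mult.commute)
    then show ?thesis using * unfolding sat_span_def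
      by (auto intro!: exI[of _ p] exI[of _ "a \<cdot>\<^sub>v c"])
  qed
  have sat: "u \<in> sat_span n vs" if "q \<noteq> 0" "u \<in> carrier_vec n" "q \<cdot>\<^sub>v u \<in> sat_span n vs" for q u
  proof -
    from that obtain p c where *: "p \<noteq> 0" "c \<in> carrier_vec ?k" "p \<cdot>\<^sub>v (q \<cdot>\<^sub>v u) = ?A *\<^sub>v c"
      by (auto simp: sat_span_def)
    then show ?thesis using that unfolding sat_span_def
      by (auto intro!: exI[of _ "p * q"] exI[of _ c] simp: smult_smult_assoc)
  qed
  have "1 \<cdot>\<^sub>v 0\<^sub>v n = ?A *\<^sub>v 0\<^sub>v ?k" using mult_mat_vec_zero[of ?A] by simp
  then have "0\<^sub>v n \<in> sat_span n vs" unfolding sat_span_def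
    by (intro CollectI conjI exI[of _ 1] exI[of _ "0\<^sub>v ?k"]) simp_all
  moreover have "sat_span n vs \<subseteq> carrier_vec n" by (auto simp: sat_span_def)
  ultimately show ?thesis using add smult sat unfolding saturated_def by blast
qed

text \<open>Converse of \<open>free_list_snoc\<close>; it supports inductions that append one vector
  at a time.\<close>

lemma free_list_snocD:
  assumes "free_list n (vs @ [x])"
  shows "free_list n vs" "x \<in> carrier_vec n" "x \<notin> sat_span n vs"
proof -
  let ?k = "length vs"
  show x: "x \<in> carrier_vec n" using assms by (auto simp: free_list_def)
  have zero: "c = 0\<^sub>v ?k \<and> a = 0" if c: "c \<in> carrier_vec ?k"
    and e: "mat_of_cols n vs *\<^sub>v c + a \<cdot>\<^sub>v x = 0\<^sub>v n" for c a
  proof -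
    let ?d = "vec (Suc ?k) (\<lambda>i. if i < ?k then c $ i else a)"
    have "vec ?k (($) ?d) = c" using c by (intro eq_vecI) auto
    then have "mat_of_cols n (vs @ [x]) *\<^sub>v ?d = 0\<^sub>v n"
      using e x by (subst mat_of_cols_snoc_mult_vec) auto
    then have d: "?d = 0\<^sub>v (Suc ?k)" using assms by (auto simp: free_list_def)
    have "c $ i = 0" if "i < ?k" for i
      using that arg_cong[OF d, of "\<lambda>v. v $ i"] by simp
    moreover have "a = 0" using arg_cong[OF d, of "\<lambda>v. v $ ?k"] by simp
    ultimately show ?thesis using c by (auto intro!: eq_vecI)
  qed
  have "c = 0\<^sub>v ?k" if "c \<in> carrier_vec ?k" "mat_of_cols n vs *\<^sub>v c = 0\<^sub>v n" for c
    using that zero[of c 0] x by (simp add: vec_smult_zero)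
  then show "free_list n vs" using assms by (auto simp: free_list_def)
  show "x \<notin> sat_span n vs"
  proof
    assume "x \<in> sat_span n vs"
    then obtain q c where q: "q \<noteq> 0" "c \<in> carrier_vec ?k" "q \<cdot>\<^sub>v x = mat_of_cols n vs *\<^sub>v c"
      by (auto simp: sat_span_def)
    have "mat_of_cols n vs *\<^sub>v c + (- q) \<cdot>\<^sub>v x = 0\<^sub>v n"
      unfolding q(3)[symmetric] using x by (intro eq_vecI) auto
    with zero q show False by fastforce
  qed
qed

lemma sat_span_mono:
  assumes "set us \<subseteq> set vs" "set vs \<subseteq> carrier_vec n"
  shows "sat_span n us \<subseteq> sat_span n vs"
  using assms subset_sat_span[of vs n] by (intro saturated_sat_span_subset saturated_sat_span) auto

lemma free_list_filter: "free_list n vs \<Longrightarrow> free_list n (filter P vs)"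
proof (induction vs rule: rev_induct)
  case (snoc x xs)
  note xs = free_list_snocD[OF snoc.prems]
  have "sat_span n (filter P xs) \<subseteq> sat_span n xs"
    using xs(1) by (intro sat_span_mono) (auto simp: free_list_def)
  then show ?case using snoc.IH[OF xs(1)] xs(2,3) by (auto intro!: free_list_snoc)
qed simp

section \<open>Degrees and minimal bases of polynomial vectors\<close>

lemma vec_degree_le_iff: "vec_degree v \<le> d \<longleftrightarrow> (\<forall>i<dim_vec v. degree (v $ i) \<le> d)"
  by (auto simp: vec_degree_def)

lemma degree_le_vec_degree: "i < dim_vec v \<Longrightarrow> degree (v $ i) \<le> vec_degree v"
  using vec_degree_le_iff[of v "vec_degree v"] by auto

lemma vec_degree_attained:
  assumes "vec_degree v > 0"
  obtains i where "i < dim_vec v" "degree (v $ i) = vec_degree v"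
proof -
  have "vec_degree v \<in> insert 0 ((\<lambda>i. degree (v $ i)) ` {..<dim_vec v})"
    unfolding vec_degree_def by (intro Max_in) auto
  with assms that show thesis by auto
qed

text \<open>Degrees of nonzero entries add over a domain. If \<open>u\<close> has degree 0, the
  maximum may stem from the inserted 0, so any nonzero entry is used for the lower bound.\<close>

lemma vec_degree_smult:
  fixes u :: "'a::idom poly vec"
  assumes "q \<noteq> 0" "u \<in> carrier_vec n" "u \<noteq> 0\<^sub>v n"
  shows "vec_degree (q \<cdot>\<^sub>v u) = degree q + vec_degree u"
proof (rule antisym)
  show "vec_degree (q \<cdot>\<^sub>v u) \<le> degree q + vec_degree u"
    using degree_le_vec_degree[of _ u]
    by (auto simp: vec_degree_le_iff intro!: order_trans[OF degree_mult_le])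
  have "degree q + degree (u $ i) \<le> vec_degree (q \<cdot>\<^sub>v u)" if "i < n" "u $ i \<noteq> 0" for i
    using degree_le_vec_degree[of i "q \<cdot>\<^sub>v u"] that assms by (auto simp: degree_mult_eq)
  note * = this
  obtain i where i: "i < n" "u $ i \<noteq> 0" using assms(2,3) by (metis eq_vecI index_zero_vec carrier_vecD)
  show "degree q + vec_degree u \<le> vec_degree (q \<cdot>\<^sub>v u)"
  proof (cases "vec_degree u = 0")
    case True
    then show ?thesis using *[OF i] by simp
  next
    case False
    then obtain k where "k < n" "degree (u $ k) = vec_degree u"
      using vec_degree_attained[of u] assms(2) by auto
    moreover from this False have "u $ k \<noteq> 0" by auto
    ultimately show ?thesis using * by metis
  qed
qed

text \<open>A polynomial basis of a rational subspace, described through the set \<open>W\<close> of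
  its polynomial vectors. It generates \<open>W\<close> only up to denominators; generation over the
  polynomials is a consequence of minimality.\<close>

definition poly_basis :: "nat \<Rightarrow> 'a::field poly vec set \<Rightarrow> 'a poly vec list \<Rightarrow> bool" where
  "poly_basis n W vs \<longleftrightarrow> free_list n vs \<and> sat_span n vs = W"

definition min_poly_basis :: "nat \<Rightarrow> 'a::field poly vec set \<Rightarrow> 'a poly vec list \<Rightarrow> bool" where
  "min_poly_basis n W vs \<longleftrightarrow> poly_basis n W vs \<and>
     (\<forall>ws. poly_basis n W ws \<longrightarrow> sum_list (map vec_degree vs) \<le> sum_list (map vec_degree ws))"

text \<open>Steinitz exchange with denominators: since \<open>g $ j\<close> is nonzero, the relation
  \<open>eq\<close> can be solved for \<open>vs ! j\<close> after multiplication by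
  \<open>g $ j\<close>, so \<open>w\<close> can take its place.\<close>

lemma poly_basis_exchange:
  assumes basis: "poly_basis n W vs" and j: "j < length vs" and q: "q \<noteq> 0"
    and g: "g \<in> carrier_vec (length vs)" "g $ j \<noteq> 0" and w: "w \<in> carrier_vec n"
    and eq: "q \<cdot>\<^sub>v w = mat_of_cols n vs *\<^sub>v g"
  shows "poly_basis n W (vs[j := w])"
proof -
  let ?k = "length vs" and ?vs = "vs[j := w]"
  let ?A = "mat_of_cols n vs" and ?A' = "mat_of_cols n ?vs"
  have vs: "set vs \<subseteq> carrier_vec n" and free: "free_list n vs"
    using basis by (auto simp: poly_basis_def free_list_def)
  have vs': "set ?vs \<subseteq> carrier_vec n" using vs w set_update_subset_insert[of vs j w] by auto
  have remove_j: "(\<Sum>i<?k. f i) = f j + (\<Sum>i\<in>{..<?k} - {j}. f i)" for f :: "nat \<Rightarrow> 'a poly"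
    using j by (intro sum.remove) auto
  have A': "(?A' *\<^sub>v c) $ r = w $ r * c $ j + (\<Sum>i\<in>{..<?k} - {j}. vs ! i $ r * c $ i)"
    if "r < n" "c \<in> carrier_vec ?k" for r c
    using that j by (simp add: mat_of_cols_mult_vec_index remove_j del: index_mult_mat_vec)
  have A: "(?A *\<^sub>v c) $ r = vs ! j $ r * c $ j + (\<Sum>i\<in>{..<?k} - {j}. vs ! i $ r * c $ i)"
    if "r < n" "c \<in> carrier_vec ?k" for r c
    using that j by (simp add: mat_of_cols_mult_vec_index remove_j del: index_mult_mat_vec)
  have qw: "q * w $ r = vs ! j $ r * g $ j + (\<Sum>i\<in>{..<?k} - {j}. vs ! i $ r * g $ i)" if "r < n" for r
    using A[OF that g(1)] arg_cong[OF eq, of "\<lambda>v. v $ r"] that w by (simp del: index_mult_mat_vec)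
  \<comment> \<open>Change of coefficients between the two lists. \<open>?c1\<close> multiplies by
    \<open>q\<close> and substitutes \<open>eq\<close> for \<open>q\<close> times \<open>w\<close>;
    \<open>?c2\<close> multiplies by \<open>g $ j\<close> and substitutes the same relation solved
    for \<open>vs ! j\<close>.\<close>
  let ?c1 = "\<lambda>c. vec ?k (\<lambda>i. if i = j then c $ j * g $ j else q * c $ i + c $ j * g $ i)"
  let ?c2 = "\<lambda>c. vec ?k (\<lambda>i. if i = j then c $ j * q else g $ j * c $ i - c $ j * g $ i)"
  have to_vs: "q \<cdot>\<^sub>v (?A' *\<^sub>v c) = ?A *\<^sub>v ?c1 c" if c: "c \<in> carrier_vec ?k" for c
  proof (intro eq_vecI)
    fix r assume "r < dim_vec (?A *\<^sub>v ?c1 c)"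
    then have r: "r < n" by simp
    have "(q \<cdot>\<^sub>v (?A' *\<^sub>v c)) $ r = (q * w $ r) * c $ j + (\<Sum>i\<in>{..<?k} - {j}. q * (vs ! i $ r * c $ i))"
      using r by (simp add: A'[OF r c] algebra_simps sum_distrib_left del: index_mult_mat_vec)
    also have "\<dots> = (?A *\<^sub>v ?c1 c) $ r"
      unfolding qw[OF r] using r j
      by (simp add: A algebra_simps sum_distrib_left sum_distrib_right sum.distrib del: index_mult_mat_vec)
    finally show "(q \<cdot>\<^sub>v (?A' *\<^sub>v c)) $ r = (?A *\<^sub>v ?c1 c) $ r" .
  qed simp
  have to_vs': "g $ j \<cdot>\<^sub>v (?A *\<^sub>v c) = ?A' *\<^sub>v ?c2 c" if c: "c \<in> carrier_vec ?k" for c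
  proof (intro eq_vecI)
    fix r assume "r < dim_vec (?A' *\<^sub>v ?c2 c)"
    then have r: "r < n" by simp
    have "(?A' *\<^sub>v ?c2 c) $ r = (q * w $ r) * c $ j
        + (\<Sum>i\<in>{..<?k} - {j}. vs ! i $ r * (g $ j * c $ i - c $ j * g $ i))"
      using r j by (simp add: A' algebra_simps del: index_mult_mat_vec)
    also have "\<dots> = (g $ j \<cdot>\<^sub>v (?A *\<^sub>v c)) $ r"
      unfolding qw[OF r] using r j
      by (simp add: A[OF r c] algebra_simps sum_distrib_left sum_distrib_right sum_subtractf
          del: index_mult_mat_vec)
    finally show "(g $ j \<cdot>\<^sub>v (?A *\<^sub>v c)) $ r = (?A' *\<^sub>v ?c2 c) $ r" by simp
  qed simp
  have "c = 0\<^sub>v ?k" if c: "c \<in> carrier_vec ?k" and 0: "?A' *\<^sub>v c = 0\<^sub>v n" for c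
  proof -
    have "?A *\<^sub>v ?c1 c = 0\<^sub>v n" using to_vs[OF c] 0 by simp
    then have z: "?c1 c = 0\<^sub>v ?k" using free by (auto simp: free_list_def)
    have cj: "c $ j = 0" using arg_cong[OF z, of "\<lambda>v. v $ j"] j g by simp
    have "c $ i = 0" if "i < ?k" for i
      using arg_cong[OF z, of "\<lambda>v. v $ i"] that cj q by (cases "i = j") auto
    then show ?thesis using c by (intro eq_vecI) auto
  qed
  then have "free_list n ?vs" using vs' by (auto simp: free_list_def)
  moreover have "sat_span n ?vs = sat_span n vs"
  proof (intro subset_antisym subsetI)
    fix u assume "u \<in> sat_span n ?vs"
    then obtain s c where "u \<in> carrier_vec n" "s \<noteq> 0" "c \<in> carrier_vec ?k" "s \<cdot>\<^sub>v u = ?A' *\<^sub>v c"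
      by (auto simp: sat_span_def)
    then show "u \<in> sat_span n vs" using to_vs[of c] q unfolding sat_span_def
      by (auto intro!: exI[of _ "q * s"] exI[of _ "?c1 c"] simp: smult_smult_assoc[symmetric])
  next
    fix u assume "u \<in> sat_span n vs"
    then obtain s c where "u \<in> carrier_vec n" "s \<noteq> 0" "c \<in> carrier_vec ?k" "s \<cdot>\<^sub>v u = ?A *\<^sub>v c"
      by (auto simp: sat_span_def)
    then show "u \<in> sat_span n ?vs" using to_vs'[of c] g(2) unfolding sat_span_def
      by (auto intro!: exI[of _ "g $ j * s"] exI[of _ "?c2 c"] simp: smult_smult_assoc[symmetric])
  qed
  ultimately show ?thesis using basis by (simp add: poly_basis_def)
qed

text \<open>The exchange changes a single summand of the degree sum, and minimality forbids that the
  sum drops.\<close>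

lemma min_poly_basis_exchange_degree:
  assumes min: "min_poly_basis n W vs" and j: "j < length vs" and q: "q \<noteq> 0"
    and g: "g \<in> carrier_vec (length vs)" "g $ j \<noteq> 0" and w: "w \<in> carrier_vec n"
    and eq: "q \<cdot>\<^sub>v w = mat_of_cols n vs *\<^sub>v g"
  shows "vec_degree (vs ! j) \<le> vec_degree w"
proof -
  have "poly_basis n W (vs[j := w])"
    using min assms by (intro poly_basis_exchange[OF _ j q g w eq]) (simp add: min_poly_basis_def)
  then have "sum_list (map vec_degree vs) \<le> sum_list (map vec_degree (vs[j := w]))"
    using min by (simp add: min_poly_basis_def)
  moreover have "vec_degree (vs ! j) \<le> sum_list (map vec_degree vs)"
    using j by (intro member_le_sum_list) auto
  ultimately show ?thesis using j by (simp add: map_update sum_list_update)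
qed

lemma finite_argmax:
  fixes f :: "'c \<Rightarrow> nat"
  assumes "finite I" "I \<noteq> {}"
  obtains j where "j \<in> I" "\<And>i. i \<in> I \<Longrightarrow> f i \<le> f j"
proof -
  have "Max (f ` I) \<in> f ` I" using assms by (intro Max_in) auto
  then obtain j where "j \<in> I" "f j = Max (f ` I)" by auto
  then show thesis using that assms(1) by simp
qed

text \<open>Dividing the coefficients by a common denominator leaves a remainder which, if nonzero, could
  replace a basis vector of larger degree.\<close>

lemma min_poly_basis_integral:
  assumes min: "min_poly_basis n W vs" and u: "u \<in> W"
  obtains c where "c \<in> carrier_vec (length vs)" "u = mat_of_cols n vs *\<^sub>v c"
proof -
  let ?k = "length vs" and ?A = "mat_of_cols n vs"
  have A: "?A \<in> carrier_mat n ?k" by simp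
  have vs: "set vs \<subseteq> carrier_vec n" using min by (auto simp: min_poly_basis_def poly_basis_def free_list_def)
  have "u \<in> sat_span n vs" using min u by (simp add: min_poly_basis_def poly_basis_def)
  then obtain q c where q: "q \<noteq> 0" and un: "u \<in> carrier_vec n" and c: "c \<in> carrier_vec ?k"
    and eq: "q \<cdot>\<^sub>v u = ?A *\<^sub>v c" by (auto simp: sat_span_def)
  \<comment> \<open>Each coefficient is divided by \<open>q\<close>. The quotients \<open>s\<close>
    give a polynomial combination, and \<open>t\<close> describes the remaining vector
    \<open>w\<close> over the denominator \<open>q\<close>.\<close>
  define s t where "s = vec ?k (\<lambda>i. c $ i div q)" and "t = vec ?k (\<lambda>i. c $ i mod q)"
  have st: "s \<in> carrier_vec ?k" "t \<in> carrier_vec ?k" by (auto simp: s_def t_def)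
  have cst: "c = q \<cdot>\<^sub>v s + t" using c by (intro eq_vecI) (auto simp: s_def t_def)
  define w where "w = u - ?A *\<^sub>v s"
  have w: "w \<in> carrier_vec n" using un by (simp add: w_def)
  have "?A *\<^sub>v c = q \<cdot>\<^sub>v (?A *\<^sub>v s) + ?A *\<^sub>v t"
    unfolding cst using st by (simp add: mult_add_distrib_mat_vec[OF A] mat_vec_smult[OF A])
  then have qw: "q \<cdot>\<^sub>v w = ?A *\<^sub>v t"
    unfolding w_def eq[symmetric] using un
    by (auto simp: vec_eq_iff algebra_simps simp del: index_mult_mat_vec)
  have "t = 0\<^sub>v ?k"
  proof (rule ccontr)
    assume t0: "t \<noteq> 0\<^sub>v ?k"
    let ?I = "{i. i < ?k \<and> t $ i \<noteq> 0}"
    have "?I \<noteq> {}" using t0 st(2) by (auto intro!: eq_vecI)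
    \<comment> \<open>Among the vectors with nonzero remainder, \<open>j\<close> has the largest
      degree. Exchange gives \<open>deg w\<close> at least that degree, while all remainders have
      degree below that of \<open>q\<close>, which makes \<open>q\<close> times \<open>w\<close> too
      small.\<close>
    then obtain j where j: "j \<in> ?I" and jmax: "\<And>i. i \<in> ?I \<Longrightarrow> vec_degree (vs ! i) \<le> vec_degree (vs ! j)"
      using finite_argmax[of ?I "\<lambda>i. vec_degree (vs ! i)"] by auto
    have le: "vec_degree (vs ! j) \<le> vec_degree w"
      using j by (intro min_poly_basis_exchange_degree[OF min _ q st(2) _ w qw]) auto
    \<comment> \<open>A nonzero remainder shows that \<open>q\<close> is not constant, so the
      natural subtraction \<open>degree q - 1\<close> is not truncated.\<close>
    have "degree (t $ j) < degree q"
      using j degree_mod_less[OF q, of "c $ j"] by (auto simp: t_def)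
    then have q0: "degree q > 0" by simp
    have "w \<noteq> 0\<^sub>v n"
    proof
      assume "w = 0\<^sub>v n"
      then have "?A *\<^sub>v t = 0\<^sub>v n" using qw by simp
      then show False using t0 st min by (auto simp: min_poly_basis_def poly_basis_def free_list_def)
    qed
    then have "degree q + vec_degree w = vec_degree (?A *\<^sub>v t)"
      using vec_degree_smult[OF q w] qw by simp
    also have "\<dots> \<le> (degree q - 1) + vec_degree (vs ! j)"
      unfolding vec_degree_le_iff
    proof (intro allI impI)
      fix r assume "r < dim_vec (?A *\<^sub>v t)"
      then have r: "r < n" by simp
      have "degree (vs ! i $ r * t $ i) \<le> (degree q - 1) + vec_degree (vs ! j)" if i: "i < ?k" for i
      proof (cases "t $ i = 0")
        case False
        have "degree (t $ i) < degree q"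
          using False i degree_mod_less[OF q, of "c $ i"] by (auto simp: t_def)
        moreover have "degree (vs ! i $ r) \<le> vec_degree (vs ! i)"
          using vs i r by (intro degree_le_vec_degree) (metis carrier_vecD nth_mem subsetD)
        moreover have "vec_degree (vs ! i) \<le> vec_degree (vs ! j)" using False i by (intro jmax) auto
        moreover have "degree (vs ! i $ r * t $ i) \<le> degree (vs ! i $ r) + degree (t $ i)"
          by (rule degree_mult_le)
        ultimately show ?thesis by linarith
      qed simp
      then show "degree ((?A *\<^sub>v t) $ r) \<le> (degree q - 1) + vec_degree (vs ! j)"
        using r st by (auto simp: mat_of_cols_mult_vec_index simp del: index_mult_mat_vec intro!: degree_sum_le)
    qed
    finally show False using le q0 by linarith
  qed
  then have "q \<cdot>\<^sub>v w = 0\<^sub>v n" using qw mult_mat_vec_zero[of ?A] by simp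
  then have "w $ i = 0" if "i < n" for i
    using that q w by (metis carrier_vecD index_smult_vec(1) index_zero_vec(1) mult_eq_0_iff)
  then have "u = ?A *\<^sub>v s" using un w_def
    by (intro eq_vecI) (auto simp del: index_mult_mat_vec)
  with st that show thesis by blast
qed

text \<open>Only the summand with index \<open>a\<close> survives. Upper bounds are used instead of
  exact degrees because an entry of a vector may have smaller degree than the vector.\<close>

lemma coeff_mult_degree_bounds:
  fixes p q :: "'a::comm_semiring_0 poly"
  assumes "degree p \<le> a" "degree q \<le> b"
  shows "coeff (p * q) (a + b) = coeff p a * coeff q b"
proof -
  have "coeff (p * q) (a + b) = (\<Sum>i\<le>a + b. coeff p i * coeff q (a + b - i))" by (rule coeff_mult)
  also have "\<dots> = (\<Sum>i\<in>{a}. coeff p i * coeff q (a + b - i))"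
  proof (intro sum.mono_neutral_right ballI)
    fix i assume "i \<in> {..a + b} - {a}"
    then consider "i > a" | "i < a" "a + b - i > b" by fastforce
    then show "coeff p i * coeff q (a + b - i) = 0"
      using assms by cases (auto simp: coeff_eq_0)
  qed auto
  finally show ?thesis by simp
qed

text \<open>If the top coefficients cancelled, the corresponding homogenised combination would replace a
  basis vector by one of smaller degree.\<close>

lemma min_poly_basis_predictable_degree:
  assumes min: "min_poly_basis n W vs" and c: "c \<in> carrier_vec (length vs)"
    and j0: "j0 < length vs" "c $ j0 \<noteq> 0"
  shows "degree (c $ j0) + vec_degree (vs ! j0) \<le> vec_degree (mat_of_cols n vs *\<^sub>v c)"
proof (rule ccontr)
  let ?k = "length vs" and ?A = "mat_of_cols n vs" and ?d = "\<lambda>i. vec_degree (vs ! i)"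
  assume "\<not> ?thesis"
  then have small: "vec_degree (?A *\<^sub>v c) < degree (c $ j0) + ?d j0" by simp
  have vs: "set vs \<subseteq> carrier_vec n" and free: "free_list n vs"
    using min by (auto simp: min_poly_basis_def poly_basis_def free_list_def)
  let ?I = "{i. i < ?k \<and> c $ i \<noteq> 0}"
  \<comment> \<open>The degree the combination would have if no top coefficients cancelled; the
    assumption makes its actual degree smaller.\<close>
  define D where "D = Max ((\<lambda>i. degree (c $ i) + ?d i) ` ?I)"
  have D_ge: "degree (c $ i) + ?d i \<le> D" if "i < ?k" "c $ i \<noteq> 0" for i
    unfolding D_def using that by (intro Max_ge) auto
  have "D \<in> (\<lambda>i. degree (c $ i) + ?d i) ` ?I" unfolding D_def using j0 by (intro Max_in) auto
  then obtain j1 where j1: "j1 < ?k" "c $ j1 \<noteq> 0" "D = degree (c $ j1) + ?d j1" by auto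
  \<comment> \<open>The part of \<open>c $ i\<close> that contributes to degree \<open>D\<close> in
    the product with \<open>vs ! i\<close>.\<close>
  define a where "a i = (if c $ i = 0 then 0 else coeff (c $ i) (D - ?d i))" for i
  let ?J = "{i. i < ?k \<and> a i \<noteq> 0}"
  have "a j1 \<noteq> 0" using j1 by (auto simp: a_def)
  then have "?J \<noteq> {}" using j1 by auto
  then obtain j where j: "j \<in> ?J" and jmax: "\<And>i. i \<in> ?J \<Longrightarrow> ?d i \<le> ?d j"
    using finite_argmax[of ?J ?d] by auto
  have deg_vs: "degree (vs ! i $ r) \<le> ?d i" if "i < ?k" "r < n" for i r
    using vs that by (intro degree_le_vec_degree) (metis carrier_vecD nth_mem subsetD)
  \<comment> \<open>Coefficients at \<open>D\<close> are compared in each entry: the combination has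
    none, so the vectors of top coefficients satisfy a linear relation with weights
    \<open>a\<close>.\<close>
  have cancel: "(\<Sum>i<?k. coeff (vs ! i $ r) (?d i) * a i) = 0" if r: "r < n" for r
  proof -
    have "coeff (vs ! i $ r * c $ i) D = coeff (vs ! i $ r) (?d i) * a i" if i: "i < ?k" for i
    proof (cases "c $ i = 0")
      case False
      then have "degree (c $ i) \<le> D - ?d i" "D = ?d i + (D - ?d i)" using D_ge[OF i] by auto
      then show ?thesis using coeff_mult_degree_bounds[OF deg_vs[OF i r], of "c $ i" "D - ?d i"] False
        by (simp add: a_def)
    qed (simp add: a_def)
    then have "(\<Sum>i<?k. coeff (vs ! i $ r) (?d i) * a i) = coeff ((?A *\<^sub>v c) $ r) D"
      using r c by (simp add: mat_of_cols_mult_vec_index coeff_sum del: index_mult_mat_vec)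
    also have "degree ((?A *\<^sub>v c) $ r) < D"
      using degree_le_vec_degree[of r "?A *\<^sub>v c"] small D_ge[OF j0] r by simp
    then have "coeff ((?A *\<^sub>v c) $ r) D = 0" by (rule coeff_eq_0)
    finally show ?thesis .
  qed
  \<comment> \<open>Monomial factors raise every vector with nonzero weight to the common degree
    \<open>?d j\<close>; by \<open>cancel\<close> their top coefficients then add up to zero. At
    \<open>j\<close> the factor is a nonzero constant, so exchange applies to the sum.\<close>
  define g where "g = vec ?k (\<lambda>i. monom (a i) (?d j - ?d i))"
  have g: "g \<in> carrier_vec ?k" "g $ j \<noteq> 0" using j by (auto simp: g_def)
  let ?w = "?A *\<^sub>v g"
  have w_deg: "degree (?w $ r) \<le> ?d j \<and> coeff (?w $ r) (?d j) = 0" if r: "r < n" for r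
  proof -
    have *: "degree (vs ! i $ r * g $ i) \<le> ?d j \<and>
        coeff (vs ! i $ r * g $ i) (?d j) = coeff (vs ! i $ r) (?d i) * a i" if i: "i < ?k" for i
    proof (cases "a i = 0")
      case False
      then have le: "?d i \<le> ?d j" using i by (intro jmax) auto
      have dg: "degree (g $ i) \<le> ?d j - ?d i" using i by (simp add: g_def degree_monom_le)
      have "degree (vs ! i $ r * g $ i) \<le> ?d j"
        using degree_mult_le[of "vs ! i $ r" "g $ i"] dg deg_vs[OF i r] le by linarith
      then show ?thesis using coeff_mult_degree_bounds[OF deg_vs[OF i r] dg] le i by (simp add: g_def)
    qed (use i in \<open>simp add: g_def\<close>)
    have "coeff (?w $ r) (?d j) = (\<Sum>i<?k. coeff (vs ! i $ r * g $ i) (?d j))"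
      using r g by (simp add: mat_of_cols_mult_vec_index coeff_sum del: index_mult_mat_vec)
    also have "\<dots> = 0" using cancel[OF r] * by simp
    finally show ?thesis using * r g
      by (auto simp: mat_of_cols_mult_vec_index simp del: index_mult_mat_vec intro!: degree_sum_le)
  qed
  have "?d j \<le> vec_degree ?w"
    using j g by (intro min_poly_basis_exchange_degree[OF min, where q = 1 and g = g]) auto
  moreover have "vec_degree ?w \<le> ?d j" using w_deg by (simp add: vec_degree_le_iff)
  ultimately have eq: "vec_degree ?w = ?d j" by simp
  \<comment> \<open>By exchange the degree of \<open>?w\<close> is exactly \<open>?d j\<close>,
    although the coefficients there vanish. For \<open>?d j = 0\<close> this is possible only for
    the zero vector, whose degree is 0 by convention, and freeness excludes it.\<close>
  show False
  proof (cases "?d j = 0")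
    case True
    have "?w $ r = 0" if "r < n" for r
      using w_deg[OF that] True by (metis le_zero_eq leading_coeff_0_iff)
    then have "?w = 0\<^sub>v n" by (intro eq_vecI) auto
    then have "g = 0\<^sub>v ?k" using free g by (auto simp: free_list_def)
    then show False using g j by auto
  next
    case False
    then obtain r where r: "r < n" "degree (?w $ r) = ?d j"
      using eq vec_degree_attained[of ?w] by (metis neq0_conv dim_mult_mat_vec mat_of_cols_carrier(2))
    then have "?w $ r = 0" using w_deg[OF r(1)] by (metis leading_coeff_0_iff)
    then show False using r False by simp
  qed
qed

text \<open>A vector of \<open>vs\<close> of degree at most \<open>t\<close> is a polynomial
  combination of \<open>ws\<close>, and no degree cancels in it. So only members of
  \<open>ws\<close> of degree at most \<open>t\<close> occur, and the Steinitz bound compares the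
  two sublists.\<close>

lemma min_poly_basis_filter_length_le:
  assumes vs: "min_poly_basis n W vs" and ws: "min_poly_basis n W ws"
  shows "length (filter (\<lambda>v. vec_degree v \<le> t) vs) \<le> length (filter (\<lambda>v. vec_degree v \<le> t) ws)"
proof (rule free_list_length_le_spanning)
  let ?F = "filter (\<lambda>v. vec_degree v \<le> t)"
  show "free_list n (?F vs)"
    using vs by (intro free_list_filter) (simp add: min_poly_basis_def poly_basis_def)
  have wn: "set ws \<subseteq> carrier_vec n" using ws by (auto simp: min_poly_basis_def poly_basis_def free_list_def)
  show "set (?F vs) \<subseteq> sat_span n (?F ws)"
  proof
    fix u assume "u \<in> set (?F vs)"
    then have u: "u \<in> set vs" "vec_degree u \<le> t" by auto
    have "u \<in> W" using vs u subset_sat_span[of vs n]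
      by (auto simp: min_poly_basis_def poly_basis_def free_list_def)
    from min_poly_basis_integral[OF ws this] obtain c where
      c: "c \<in> carrier_vec (length ws)" "u = mat_of_cols n ws *\<^sub>v c" .
    have "mat_of_cols n ws *\<^sub>v c \<in> sat_span n (?F ws)"
    proof (rule saturated_mat_of_cols_mult_vec_support[OF saturated_sat_span wn c(1)])
      fix j assume j: "j < length ws" "c $ j \<noteq> 0"
      then have "vec_degree (ws ! j) \<le> t"
        using min_poly_basis_predictable_degree[OF ws c(1) j] c(2) u(2) by simp
      then have "ws ! j \<in> set (?F ws)" using j by simp
      then show "ws ! j \<in> sat_span n (?F ws)" using subset_sat_span[of "?F ws" n] wn by auto
    qed
    then show "u \<in> sat_span n (?F ws)" using c by simp
  qed
qed

text \<open>The multiplicity of \<open>Suc s\<close> is the difference of the counts at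
  \<open>Suc s\<close> and at \<open>s\<close>.\<close>

lemma mset_eq_if_filter_le_length:
  fixes xs ys :: "nat list"
  assumes "\<And>t. length (filter (\<lambda>x. x \<le> t) xs) = length (filter (\<lambda>x. x \<le> t) ys)"
  shows "mset xs = mset ys"
proof (rule multiset_eqI)
  have split: "length (filter (\<lambda>x. x \<le> Suc t) zs) = length (filter (\<lambda>x. x \<le> t) zs) + count (mset zs) (Suc t)"
    and zero: "length (filter (\<lambda>x. x \<le> 0) zs) = count (mset zs) 0" for zs :: "nat list" and t
    by (induction zs) auto
  fix t show "count (mset xs) t = count (mset ys) t"
  proof (cases t)
    case 0
    then show ?thesis using assms[of 0] by (simp only: zero)
  next
    case (Suc s)
    then show ?thesis using assms[of s] assms[of "Suc s"] by (simp only: split)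
  qed
qed

text \<open>Makes the choice of a minimal basis in the definition of the minimal indices
  harmless.\<close>

lemma min_poly_basis_degrees_unique:
  assumes "min_poly_basis n W vs" "min_poly_basis n W ws"
  shows "mset (map vec_degree vs) = mset (map vec_degree ws)"
  using min_poly_basis_filter_length_le[OF assms] min_poly_basis_filter_length_le[OF assms(2,1)]
  by (intro mset_eq_if_filter_le_length antisym) (simp_all add: filter_map comp_def)

lemma poly_basis_length_eq:
  assumes "poly_basis n W vs" "poly_basis n W ws"
  shows "length vs = length ws"
  using assms subset_sat_span[of vs n] subset_sat_span[of ws n]
  by (intro antisym free_list_length_le_spanning) (auto simp: poly_basis_def free_list_def)

lemma poly_basis_subset: "poly_basis n W vs \<Longrightarrow> set vs \<subseteq> W"
  using subset_sat_span[of vs n] by (auto simp: poly_basis_def free_list_def)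

lemma min_poly_basis_exists:
  assumes W: "saturated n W"
  obtains vs where "min_poly_basis n W vs"
proof -
  have "W \<subseteq> carrier_vec n" using W by (simp add: saturated_def)
  from maximal_free_list[OF this] obtain bs where
    bs: "free_list n bs" "set bs \<subseteq> W" "W \<subseteq> sat_span n bs" .
  with saturated_sat_span_subset[OF W bs(2)] have "poly_basis n W bs" by (auto simp: poly_basis_def)
  from ex_has_least_nat[of "poly_basis n W", OF this, of "\<lambda>vs. sum_list (map vec_degree vs)"]
  show thesis using that by (auto simp: min_poly_basis_def)
qed

section \<open>Transport of minimal bases along linear bijections that shift degrees\<close>

context
  fixes T :: "'a::field poly mat" and m n d :: nat and W W' :: "'a poly vec set"
  assumes T: "T \<in> carrier_mat m n" and W: "saturated n W" and W': "saturated m W'"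
    and img: "(*\<^sub>v) T ` W = W'"
    and inj: "\<And>u. u \<in> W \<Longrightarrow> T *\<^sub>v u = 0\<^sub>v m \<Longrightarrow> u = 0\<^sub>v n"
    and shift: "\<And>u. u \<in> W \<Longrightarrow> u \<noteq> 0\<^sub>v n \<Longrightarrow> vec_degree (T *\<^sub>v u) = vec_degree u + d"
begin

text \<open>Injectivity on \<open>W\<close> preserves freeness and surjectivity onto
  \<open>W'\<close> preserves spanning. The map \<open>T\<close> will be the transpose of
  \<open>N1\<close>, with \<open>d\<close> the degree of \<open>N1\<close>, or a coordinate
  projection, with \<open>d = 0\<close>.\<close>

lemma poly_basis_image:
  assumes vs: "poly_basis n W vs"
  shows "poly_basis m W' (map ((*\<^sub>v) T) vs)"
proof -
  note sub = poly_basis_subset[OF vs]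
  have vsn: "set vs \<subseteq> carrier_vec n" using sub W by (auto simp: saturated_def)
  have "c = 0\<^sub>v (length vs)" if c: "c \<in> carrier_vec (length vs)"
    and 0: "mat_of_cols m (map ((*\<^sub>v) T) vs) *\<^sub>v c = 0\<^sub>v m" for c
  proof -
    have "mat_of_cols n vs *\<^sub>v c = 0\<^sub>v n"
      using saturated_mat_of_cols_mult_vec[OF W sub c] 0 mult_mat_of_cols_vec[OF T vsn c]
      by (intro inj) auto
    then show ?thesis using vs c by (auto simp: poly_basis_def free_list_def)
  qed
  then have "free_list m (map ((*\<^sub>v) T) vs)" using vsn T by (auto simp: free_list_def)
  moreover have "sat_span m (map ((*\<^sub>v) T) vs) \<subseteq> W'"
    using sub img by (intro saturated_sat_span_subset[OF W']) auto
  moreover have "W' \<subseteq> sat_span m (map ((*\<^sub>v) T) vs)"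
  proof
    fix x assume "x \<in> W'"
    then obtain u where u: "u \<in> W" "x = T *\<^sub>v u" using img by auto
    then obtain q c where c: "u \<in> carrier_vec n" "q \<noteq> 0" "c \<in> carrier_vec (length vs)"
      "q \<cdot>\<^sub>v u = mat_of_cols n vs *\<^sub>v c" using vs by (auto simp: poly_basis_def sat_span_def)
    then have "q \<cdot>\<^sub>v x = mat_of_cols m (map ((*\<^sub>v) T) vs) *\<^sub>v c"
      using u mult_mat_of_cols_vec[OF T vsn c(3)] mat_vec_smult[OF T c(1)] by metis
    then show "x \<in> sat_span m (map ((*\<^sub>v) T) vs)" unfolding sat_span_def
      using c u T by (intro CollectI conjI exI[of _ q] exI[of _ c]) auto
  qed
  ultimately show ?thesis by (auto simp: poly_basis_def)
qed

lemma poly_basis_preimage: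
  assumes ws: "poly_basis m W' ws"
  obtains vs where "poly_basis n W vs" "ws = map ((*\<^sub>v) T) vs"
proof -
  have "\<forall>w \<in> set ws. \<exists>u \<in> W. w = T *\<^sub>v u" using poly_basis_subset[OF ws] img by auto
  then obtain f where f: "\<And>w. w \<in> set ws \<Longrightarrow> f w \<in> W \<and> w = T *\<^sub>v f w" by metis
  define vs where "vs = map f ws"
  have wsT: "ws = map ((*\<^sub>v) T) vs" using f by (auto simp: vs_def intro!: nth_equalityI)
  have sub: "set vs \<subseteq> W" using f by (auto simp: vs_def)
  then have vsn: "set vs \<subseteq> carrier_vec n" using W by (auto simp: saturated_def)
  have "c = 0\<^sub>v (length vs)" if c: "c \<in> carrier_vec (length vs)"
    and 0: "mat_of_cols n vs *\<^sub>v c = 0\<^sub>v n" for c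
    using mult_mat_of_cols_vec[OF T vsn c] 0 ws c wsT T mult_mat_vec_zero[of T]
    by (auto simp: poly_basis_def free_list_def)
  then have "free_list n vs" using vsn by (auto simp: free_list_def)
  moreover have "sat_span n vs \<subseteq> W" by (rule saturated_sat_span_subset[OF W sub])
  moreover have "W \<subseteq> sat_span n vs"
  proof
    fix u assume u: "u \<in> W"
    then have un: "u \<in> carrier_vec n" using W by (auto simp: saturated_def)
    have "T *\<^sub>v u \<in> sat_span m ws" using u img ws by (auto simp: poly_basis_def)
    then obtain q c where c: "q \<noteq> 0" "c \<in> carrier_vec (length vs)"
      "q \<cdot>\<^sub>v (T *\<^sub>v u) = mat_of_cols m ws *\<^sub>v c" using wsT by (auto simp: sat_span_def)
    let ?A = "mat_of_cols n vs"
    \<comment> \<open>Injectivity is known only on \<open>W\<close>, so the two sides are compared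
      through their difference, which lies in \<open>W\<close>.\<close>
    define y where "y = q \<cdot>\<^sub>v u + (- 1) \<cdot>\<^sub>v (?A *\<^sub>v c)"
    have "?A *\<^sub>v c \<in> W" by (rule saturated_mat_of_cols_mult_vec[OF W sub c(2)])
    then have yW: "y \<in> W" using u W unfolding saturated_def y_def by blast
    have "T *\<^sub>v y = q \<cdot>\<^sub>v (T *\<^sub>v u) + (- 1) \<cdot>\<^sub>v (T *\<^sub>v (?A *\<^sub>v c))"
      unfolding y_def using un by (simp add: mult_add_distrib_mat_vec[OF T] mat_vec_smult[OF T])
    also have "\<dots> = 0\<^sub>v m"
      unfolding c(3) mult_mat_of_cols_vec[OF T vsn c(2)] wsT[symmetric] by (intro eq_vecI) auto
    finally have "y = 0\<^sub>v n" using yW by (intro inj)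
    then have "q \<cdot>\<^sub>v u = ?A *\<^sub>v c" using un
      by (auto simp: y_def vec_eq_iff simp del: index_mult_mat_vec)
    then show "u \<in> sat_span n vs" unfolding sat_span_def
      using c un by (intro CollectI conjI exI[of _ q] exI[of _ c]) auto
  qed
  ultimately have "poly_basis n W vs" by (auto simp: poly_basis_def)
  with wsT that show thesis by blast
qed

lemma poly_basis_image_degrees:
  assumes "poly_basis n W vs"
  shows "map vec_degree (map ((*\<^sub>v) T) vs) = map (\<lambda>e. e + d) (map vec_degree vs)"
proof -
  \<comment> \<open>The degree shift holds only for nonzero vectors. A zero vector in the list would
    put a unit vector into the kernel of the matrix of columns.\<close>
  have "v \<noteq> 0\<^sub>v n" if "v \<in> set vs" for v
  proof
    assume "v = 0\<^sub>v n"
    then obtain xs ys where vs: "vs = xs @ 0\<^sub>v n # ys" using \<open>v \<in> set vs\<close> by (metis split_list)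
    let ?c = "unit_vec (length vs) (length xs) :: 'a poly vec"
    have "mat_of_cols n vs *\<^sub>v ?c = 0\<^sub>v n" using vs by (auto intro!: eq_vecI simp: mat_of_cols_index)
    then have "?c = 0\<^sub>v (length vs)" using assms by (auto simp: poly_basis_def free_list_def)
    then have "?c $ length xs = 0\<^sub>v (length vs) $ length xs" by simp
    then show False using vs by simp
  qed
  then show ?thesis using poly_basis_subset[OF assms] shift by auto
qed

text \<open>Bases of \<open>W'\<close> are exactly the images of bases of \<open>W\<close>. All of
  them have the same length, so \<open>T\<close> changes every degree sum by the same amount and
  preserves the minimum.\<close>

lemma min_poly_basis_image:
  assumes vs: "min_poly_basis n W vs"
  shows "min_poly_basis m W' (map ((*\<^sub>v) T) vs)"
  unfolding min_poly_basis_def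
proof (intro conjI allI impI)
  have b: "poly_basis n W vs" using vs by (simp add: min_poly_basis_def)
  then show "poly_basis m W' (map ((*\<^sub>v) T) vs)" by (rule poly_basis_image)
  fix ws assume "poly_basis m W' ws"
  then obtain us where us: "poly_basis n W us" "ws = map ((*\<^sub>v) T) us" by (rule poly_basis_preimage)
  have sum: "sum_list (map (\<lambda>e. e + d) xs) = sum_list xs + d * length xs" for xs
    by (induction xs) auto
  have "sum_list (map vec_degree vs) \<le> sum_list (map vec_degree us)"
    using vs us(1) by (simp add: min_poly_basis_def)
  then show "sum_list (map vec_degree (map ((*\<^sub>v) T) vs)) \<le> sum_list (map vec_degree ws)"
    unfolding us(2) poly_basis_image_degrees[OF b] poly_basis_image_degrees[OF us(1)] sum
    using poly_basis_length_eq[OF b us(1)] by simp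
qed

end

section \<open>Comparison with rational subspaces\<close>

text \<open>Over the field of fractions the denominator in \<open>sat_span\<close> can be
  inverted.\<close>

lemma rat_span_eq_sat_span:
  assumes ws: "set ws \<subseteq> carrier_vec n"
  shows "rat_span n (set ws) = sat_span n ws"
proof -
  interpret vec_space "TYPE('a poly fract)" n .
  have dim: "\<forall>w \<in> set ws. dim_vec w = n" using ws by auto
  have "rat_span n (set ws) = {mat_of_cols n ws *\<^sub>v vec (length ws) c | c. True}"
    unfolding rat_span_def span_list_as_span[OF ws, symmetric] span_list_def
    using lincomb_list_as_mat_mult[OF dim] by simp
  also have "\<dots> = sat_span n ws"
  proof (intro subset_antisym subsetI)
    fix x assume "x \<in> {mat_of_cols n ws *\<^sub>v vec (length ws) c | c. True}"
    then obtain c where "x = mat_of_cols n ws *\<^sub>v vec (length ws) c" by auto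
    then show "x \<in> sat_span n ws" unfolding sat_span_def
      by (intro CollectI conjI exI[of _ 1] exI[of _ "vec (length ws) c"]) auto
  next
    fix x assume "x \<in> sat_span n ws"
    then obtain q c where c: "x \<in> carrier_vec n" "q \<noteq> 0" "c \<in> carrier_vec (length ws)"
      "q \<cdot>\<^sub>v x = mat_of_cols n ws *\<^sub>v c" by (auto simp: sat_span_def)
    have "x = inverse q \<cdot>\<^sub>v (q \<cdot>\<^sub>v x)" using c(1,2) by (simp add: smult_smult_assoc)
    also have "\<dots> = mat_of_cols n ws *\<^sub>v (inverse q \<cdot>\<^sub>v c)"
      unfolding c(4) using c(3) by (simp add: mat_vec_smult[where n = "length ws" and m = n])
    also have "inverse q \<cdot>\<^sub>v c = vec (length ws) (($) (inverse q \<cdot>\<^sub>v c))" using c by (intro eq_vecI) auto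
    finally show "x \<in> {mat_of_cols n ws *\<^sub>v vec (length ws) c | c. True}" by blast
  qed
  finally show ?thesis .
qed

lemma rat_lin_indep_iff_free_list:
  assumes ws: "set ws \<subseteq> carrier_vec n"
  shows "distinct ws \<and> rat_lin_indep n (set ws) \<longleftrightarrow> free_list n ws"
proof -
  interpret vec_space "TYPE('a poly fract)" n .
  have dim: "\<forall>w \<in> set ws. dim_vec w = n" using ws by auto
  have comb: "lincomb f (set ws) = mat_of_cols n ws *\<^sub>v vec (length ws) (\<lambda>i. f (ws ! i))"
    if "distinct ws" for f
    using lincomb_as_lincomb_list_distinct[OF ws that] lincomb_list_as_mat_mult[OF dim] by simp
  show ?thesis
  proof
    assume *: "distinct ws \<and> rat_lin_indep n (set ws)"
    have "c = 0\<^sub>v (length ws)" if c: "c \<in> carrier_vec (length ws)"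
      and 0: "mat_of_cols n ws *\<^sub>v c = 0\<^sub>v n" for c
    proof -
      \<comment> \<open>Coefficients indexed by positions are turned into coefficients indexed by
        vectors, which is well defined because the list is distinct.\<close>
      let ?f = "\<lambda>w. c $ (the_inv_into {..<length ws} ((!) ws) w)"
      have inj: "inj_on ((!) ws) {..<length ws}" using * by (auto intro: inj_on_nth)
      have "vec (length ws) (\<lambda>i. ?f (ws ! i)) = c"
        using c by (intro eq_vecI) (auto simp: the_inv_into_f_f[OF inj])
      then have "lincomb ?f (set ws) = 0\<^sub>v n" using comb * 0 by simp
      then have f0: "?f w = 0" if "w \<in> set ws" for w
        using * that ws unfolding rat_lin_indep_def lin_dep_def by (metis List.finite_set order_refl)
      have "c $ i = 0" if "i < length ws" for i
        using f0[of "ws ! i"] that by (auto simp: the_inv_into_f_f[OF inj])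
      then show ?thesis using c by (intro eq_vecI) auto
    qed
    then show "free_list n ws" using ws by (auto simp: free_list_def)
  next
    assume free: "free_list n ws"
    have "distinct ws" using free
    proof (induction ws rule: rev_induct)
      case (snoc x xs)
      note D = free_list_snocD[OF snoc.prems]
      then show ?case using snoc.IH[OF D(1)] subset_sat_span[of xs n] by (auto simp: free_list_def)
    qed simp
    moreover have "lin_indpt (set ws)"
    proof (rule finite_lin_indpt2)
      fix f assume "lincomb f (set ws) = 0\<^sub>v n"
      then have "vec (length ws) (\<lambda>i. f (ws ! i)) = 0\<^sub>v (length ws)"
        using free comb[OF \<open>distinct ws\<close>] by (auto simp: free_list_def)
      then have "f (ws ! i) = 0" if "i < length ws" for i using that by (metis index_vec index_zero_vec(1))
      then show "\<forall>v \<in> set ws. f v = 0" by (auto simp: in_set_conv_nth)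
    qed (use ws in auto)
    ultimately show "distinct ws \<and> rat_lin_indep n (set ws)" by (simp add: rat_lin_indep_def)
  qed
qed

section \<open>Passage between polynomial and rational vectors\<close>

lemma rat_vec_carrier [simp]: "rat_vec u \<in> carrier_vec n \<longleftrightarrow> u \<in> carrier_vec n"
  by (simp add: rat_vec_def)

lemma rat_vec_inj: "rat_vec u = rat_vec v \<longleftrightarrow> u = v"
  by (auto simp: rat_vec_def vec_eq_iff)

lemma rat_vec_zero: "rat_vec (0\<^sub>v n) = 0\<^sub>v n"
  by (auto simp: rat_vec_def)

lemma rat_vec_smult: "rat_vec (q \<cdot>\<^sub>v u) = to_fract q \<cdot>\<^sub>v rat_vec u"
  by (auto simp: rat_vec_def)

lemma rat_mat_mult_vec:
  assumes "A \<in> carrier_mat m n" "u \<in> carrier_vec n"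
  shows "rat_vec (A *\<^sub>v u) = rat_mat A *\<^sub>v rat_vec u"
proof -
  interpret comm_ring_hom "to_fract :: 'a poly \<Rightarrow> 'a poly fract" by unfold_locales auto
  show ?thesis unfolding rat_vec_def rat_mat_def using mult_mat_vec_hom[OF assms] .
qed

lemma rat_mat_of_cols:
  assumes "set vs \<subseteq> carrier_vec n"
  shows "rat_mat (mat_of_cols n vs) = mat_of_cols n (map rat_vec vs)"
proof (rule eq_matI)
  fix i j assume "i < dim_row (mat_of_cols n (map rat_vec vs))" "j < dim_col (mat_of_cols n (map rat_vec vs))"
  then have ij: "i < n" "j < length vs" by auto
  then have "vs ! j \<in> carrier_vec n" using assms by auto
  then show "rat_mat (mat_of_cols n vs) $$ (i, j) = mat_of_cols n (map rat_vec vs) $$ (i, j)"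
    using ij by (simp add: rat_mat_def rat_vec_def mat_of_cols_index)
qed (auto simp: rat_mat_def)

text \<open>Induction on the number of entries already cleared: the denominator of the next entry is
  multiplied into \<open>q\<close>.\<close>

lemma clear_denominators:
  fixes x :: "'a::field poly fract vec"
  assumes x: "x \<in> carrier_vec n"
  obtains q u where "q \<noteq> 0" "u \<in> carrier_vec n" "to_fract q \<cdot>\<^sub>v x = rat_vec u"
proof -
  have "\<exists>q. q \<noteq> 0 \<and> (\<forall>i<k. \<exists>p. to_fract q * x $ i = to_fract p)" for k
  proof (induction k)
    case 0
    show ?case by (intro exI[of _ 1]) auto
  next
    case (Suc k)
    then obtain q where q: "q \<noteq> 0" "\<And>i. i < k \<Longrightarrow> \<exists>p. to_fract q * x $ i = to_fract p" by blast
    obtain a b where b: "x $ k = Fract a b" "b \<noteq> 0" by (cases "x $ k") auto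
    have "\<exists>p. to_fract (q * b) * x $ i = to_fract p" if "i < Suc k" for i
    proof (cases "i = k")
      case True
      have "to_fract (q * b) * x $ k = to_fract (q * a)" using b
        by (simp add: Fract_conv_to_fract)
      then show ?thesis using True by blast
    next
      case False
      then obtain p where "to_fract q * x $ i = to_fract p" using q(2)[of i] \<open>i < Suc k\<close> by auto
      then have "to_fract (q * b) * x $ i = to_fract (p * b)" by (simp add: mult.commute mult.left_commute)
      then show ?thesis by blast
    qed
    then show ?case using q(1) b(2) by (intro exI[of _ "q * b"]) auto
  qed
  from this[of n] obtain q p where q: "q \<noteq> 0" "\<And>i. i < n \<Longrightarrow> to_fract q * x $ i = to_fract (p i)" by metis
  then have "to_fract q \<cdot>\<^sub>v x = rat_vec (vec n p)" using x by (intro eq_vecI) (auto simp: rat_vec_def)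
  with q(1) that show thesis by (metis vec_carrier)
qed

text \<open>A dependence with rational coefficients becomes polynomial once its denominators are
  cleared.\<close>

lemma free_list_rat_vec:
  assumes vs: "set vs \<subseteq> carrier_vec n"
  shows "free_list n (map rat_vec vs) \<longleftrightarrow> free_list n vs"
proof
  let ?A = "mat_of_cols n vs" and ?k = "length vs"
  have A: "?A \<in> carrier_mat n ?k" by simp
  note hom = rat_mat_mult_vec[OF A, unfolded rat_mat_of_cols[OF vs]]
  show "free_list n vs" if free: "free_list n (map rat_vec vs)"
  proof -
    have "c = 0\<^sub>v ?k" if c: "c \<in> carrier_vec ?k" "?A *\<^sub>v c = 0\<^sub>v n" for c
    proof -
      have "rat_vec c = 0\<^sub>v ?k"
        using free c hom[OF c(1)] by (auto simp: free_list_def rat_vec_zero)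
      then show ?thesis by (metis rat_vec_inj rat_vec_zero)
    qed
    then show ?thesis using vs by (auto simp: free_list_def)
  qed
  show "free_list n (map rat_vec vs)" if free: "free_list n vs"
  proof -
    let ?B = "mat_of_cols n (map rat_vec vs)"
    have B: "?B \<in> carrier_mat n ?k" using mat_of_cols_carrier(1)[of n "map rat_vec vs"] by simp
    have "x = 0\<^sub>v ?k" if x: "x \<in> carrier_vec ?k" "?B *\<^sub>v x = 0\<^sub>v n" for x
    proof -
      obtain q c where q: "q \<noteq> 0" "c \<in> carrier_vec ?k" "to_fract q \<cdot>\<^sub>v x = rat_vec c"
        using clear_denominators[OF x(1)] .
      have "rat_vec (?A *\<^sub>v c) = rat_vec (0\<^sub>v n)"
        using hom[OF q(2)] x mat_vec_smult[OF B x(1), of "to_fract q"] q(3) by (simp add: rat_vec_zero)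
      then have "c = 0\<^sub>v ?k" using free q(2) by (auto simp: free_list_def rat_vec_inj)
      then have z: "to_fract q \<cdot>\<^sub>v x = 0\<^sub>v ?k" using q(3) by (simp add: rat_vec_zero)
      have "x $ i = 0" if "i < ?k" for i
        using arg_cong[OF z, of "\<lambda>v. v $ i"] that x q(1) by simp
      then show ?thesis using x by (intro eq_vecI) auto
    qed
    then show ?thesis using vs by (auto simp: free_list_def)
  qed
qed

lemma rat_vec_in_sat_span_iff:
  assumes vs: "set vs \<subseteq> carrier_vec n" and u: "u \<in> carrier_vec n"
  shows "rat_vec u \<in> sat_span n (map rat_vec vs) \<longleftrightarrow> u \<in> sat_span n vs"
proof
  let ?A = "mat_of_cols n vs" and ?k = "length vs" and ?B = "mat_of_cols n (map rat_vec vs)"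
  have A: "?A \<in> carrier_mat n ?k" by simp
  have B: "?B \<in> carrier_mat n ?k" using mat_of_cols_carrier(1)[of n "map rat_vec vs"] by simp
  note hom = rat_mat_mult_vec[OF A, unfolded rat_mat_of_cols[OF vs]]
  show "rat_vec u \<in> sat_span n (map rat_vec vs)" if "u \<in> sat_span n vs"
  proof -
    from that obtain q c where q: "q \<noteq> 0" "c \<in> carrier_vec ?k" "q \<cdot>\<^sub>v u = ?A *\<^sub>v c"
      by (auto simp: sat_span_def)
    then have "to_fract q \<cdot>\<^sub>v rat_vec u = ?B *\<^sub>v rat_vec c" using hom by (metis rat_vec_smult)
    then show ?thesis unfolding sat_span_def using q u
      by (intro CollectI conjI exI[of _ "to_fract q"] exI[of _ "rat_vec c"]) auto
  qed
  show "u \<in> sat_span n vs" if "rat_vec u \<in> sat_span n (map rat_vec vs)"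
  proof -
    from that obtain r x where r: "r \<noteq> 0" "x \<in> carrier_vec ?k" "r \<cdot>\<^sub>v rat_vec u = ?B *\<^sub>v x"
      by (auto simp: sat_span_def)
    obtain a b where ab: "r = Fract a b" "b \<noteq> 0" by (cases r) auto
    obtain q c where q: "q \<noteq> 0" "c \<in> carrier_vec ?k" "to_fract q \<cdot>\<^sub>v x = rat_vec c"
      using clear_denominators[OF r(2)] .
    have a0: "a \<noteq> 0" using r(1) ab by (auto simp: Fract_conv_to_fract)
    \<comment> \<open>With \<open>r\<close> equal to \<open>a / b\<close>, multiplication by
      \<open>b\<close> and \<open>q\<close> makes both the scalar on the left and the coefficients
      on the right polynomial.\<close>
    have "to_fract q * (to_fract b * r) = to_fract (q * a)" using ab by (simp add: Fract_conv_to_fract)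
    then have "rat_vec ((q * a) \<cdot>\<^sub>v u) = to_fract b \<cdot>\<^sub>v (to_fract q \<cdot>\<^sub>v (r \<cdot>\<^sub>v rat_vec u))"
      by (metis rat_vec_smult smult_smult_assoc mult.left_commute)
    also have "\<dots> = to_fract b \<cdot>\<^sub>v (?B *\<^sub>v rat_vec c)"
      unfolding r(3) q(3)[symmetric] using mat_vec_smult[OF B r(2)] by simp
    also have "\<dots> = rat_vec (?A *\<^sub>v (b \<cdot>\<^sub>v c))"
      using hom[of "b \<cdot>\<^sub>v c"] q(2) mat_vec_smult[OF B, of "rat_vec c" "to_fract b"] by (simp add: rat_vec_smult)
    finally have "(q * a) \<cdot>\<^sub>v u = ?A *\<^sub>v (b \<cdot>\<^sub>v c)" by (simp add: rat_vec_inj)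
    then show ?thesis unfolding sat_span_def using q a0 u
      by (intro CollectI conjI exI[of _ "q * a"] exI[of _ "b \<cdot>\<^sub>v c"]) auto
  qed
qed

lemma rat_vec_preimage_sat_span:
  assumes vs: "set vs \<subseteq> carrier_vec n"
  shows "{u \<in> carrier_vec n. rat_vec u \<in> sat_span n (map rat_vec vs)} = sat_span n vs"
proof -
  have "sat_span n vs \<subseteq> carrier_vec n" by (auto simp: sat_span_def)
  then show ?thesis using rat_vec_in_sat_span_iff[OF vs] by blast
qed

text \<open>Every rational vector has a nonzero polynomial multiple that is a polynomial vector, and
  saturation allows dividing by this factor again.\<close>

lemma saturated_determined_by_rat_vec:
  assumes V: "saturated n V" and V': "saturated n V'"
    and eq: "\<And>u. u \<in> carrier_vec n \<Longrightarrow> rat_vec u \<in> V \<longleftrightarrow> rat_vec u \<in> V'"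
  shows "V = V'"
proof -
  have "A \<subseteq> B" if A: "saturated n A" and B: "saturated n B"
    and eq: "\<And>u. u \<in> carrier_vec n \<Longrightarrow> rat_vec u \<in> A \<longleftrightarrow> rat_vec u \<in> B" for A B
  proof
    fix x assume x: "x \<in> A"
    then have xn: "x \<in> carrier_vec n" using A by (auto simp: saturated_def)
    obtain q u where q: "q \<noteq> 0" "u \<in> carrier_vec n" "to_fract q \<cdot>\<^sub>v x = rat_vec u"
      using clear_denominators[OF xn] .
    then have "rat_vec u \<in> A" using A x by (metis saturated_def)
    then have "to_fract q \<cdot>\<^sub>v x \<in> B" using eq q by simp
    moreover have "to_fract q \<noteq> 0" using q(1) by simp
    ultimately show "x \<in> B" using B xn unfolding saturated_def by blast
  qed
  from this[OF V V'] this[OF V' V] eq show ?thesis by blast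
qed

text \<open>The bridge from the set-based rational notion to lists over polynomials, on which all
  degree arguments are carried out.\<close>

lemma polynomial_basis_iff_poly_basis:
  assumes V: "saturated n V"
  shows "polynomial_basis n V vs \<longleftrightarrow> poly_basis n {u \<in> carrier_vec n. rat_vec u \<in> V} vs"
proof (cases "set vs \<subseteq> carrier_vec n")
  case True
  then have ws: "set (map rat_vec vs) \<subseteq> carrier_vec n" by auto
  have dist: "distinct vs \<longleftrightarrow> distinct (map rat_vec vs)"
    by (auto simp: distinct_map inj_on_def rat_vec_inj)
  have "distinct vs \<and> rat_lin_indep n (rat_vec ` set vs) \<longleftrightarrow> free_list n vs"
    using rat_lin_indep_iff_free_list[OF ws] free_list_rat_vec[OF True] dist by simp
  moreover have "rat_span n (rat_vec ` set vs) = sat_span n (map rat_vec vs)"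
    using rat_span_eq_sat_span[OF ws] by simp
  moreover have "sat_span n (map rat_vec vs) = V \<longleftrightarrow> sat_span n vs = {u \<in> carrier_vec n. rat_vec u \<in> V}"
  proof
    assume "sat_span n (map rat_vec vs) = V"
    then show "sat_span n vs = {u \<in> carrier_vec n. rat_vec u \<in> V}"
      using rat_vec_preimage_sat_span[OF True] by simp
  next
    assume *: "sat_span n vs = {u \<in> carrier_vec n. rat_vec u \<in> V}"
    show "sat_span n (map rat_vec vs) = V"
      using rat_vec_in_sat_span_iff[OF True] *
      by (intro saturated_determined_by_rat_vec[OF saturated_sat_span V]) auto
  qed
  ultimately show ?thesis using True by (auto simp: polynomial_basis_def poly_basis_def)
qed (auto simp: polynomial_basis_def poly_basis_def free_list_def)

lemma minimal_basis_of_iff_min_poly_basis: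
  assumes V: "saturated n V"
  shows "minimal_basis_of n V vs \<longleftrightarrow> min_poly_basis n {u \<in> carrier_vec n. rat_vec u \<in> V} vs"
  by (simp add: minimal_basis_of_def min_poly_basis_def polynomial_basis_iff_poly_basis[OF V])

text \<open>The chosen basis and \<open>vs\<close> are both minimal for the polynomial kernel, so
  uniqueness of the degrees identifies their sorted lists.\<close>

lemma right_minimal_indices_eq:
  assumes P: "P \<in> carrier_mat m n" and vs: "min_poly_basis n (mat_kernel P) vs"
  shows "right_minimal_indices P = sort (map vec_degree vs)"
proof -
  have rP: "rat_mat P \<in> carrier_mat m n" using P by (simp add: rat_mat_def)
  have "{u \<in> carrier_vec n. rat_vec u \<in> mat_kernel (rat_mat P)} = mat_kernel P"
    unfolding mat_kernel[OF P] mat_kernel[OF rP]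
    by (auto simp: rat_mat_mult_vec[OF P, symmetric] rat_vec_inj simp flip: rat_vec_zero)
  then have iff: "minimal_basis_of n (right_null_space P) = min_poly_basis n (mat_kernel P)"
    using minimal_basis_of_iff_min_poly_basis[OF saturated_mat_kernel[OF rP]]
    by (auto simp: right_null_space_def)
  have "min_poly_basis n (mat_kernel P) (SOME vs. min_poly_basis n (mat_kernel P) vs)"
    using vs by (rule someI)
  from min_poly_basis_degrees_unique[OF this vs] show ?thesis using P
    by (simp add: right_minimal_indices_def minimal_indices_def iff)
       (metis mset_map sorted_list_of_multiset_mset)
qed

lemma left_minimal_indices_transpose: "left_minimal_indices P = right_minimal_indices P\<^sup>T"
proof -
  have "left_null_space P = right_null_space P\<^sup>T"
  proof -
    have "mat_of_row y * rat_mat P = 0\<^sub>m 1 (dim_col P) \<longleftrightarrow> rat_mat P\<^sup>T *\<^sub>v y = 0\<^sub>v (dim_col P)"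
      if y: "y \<in> carrier_vec (dim_row P)" for y :: "'a poly fract vec"
    proof -
      have "(mat_of_row y * rat_mat P) $$ (0, j) = (rat_mat P\<^sup>T *\<^sub>v y) $ j" if "j < dim_col P" for j
      proof -
        have "col (rat_mat P) j = row (rat_mat P\<^sup>T) j"
          using that by (intro eq_vecI) (auto simp: rat_mat_def)
        moreover have "col (rat_mat P) j \<in> carrier_vec (dim_row P)"
          by (intro carrier_vecI) (simp add: rat_mat_def)
        from comm_scalar_prod[OF y this] have "y \<bullet> col (rat_mat P) j = col (rat_mat P) j \<bullet> y" .
        ultimately show ?thesis using that by (simp add: rat_mat_def)
      qed
      then show ?thesis by (auto simp: mat_eq_iff vec_eq_iff rat_mat_def
            simp del: index_mult_mat_vec index_mult_mat(1))
    qed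
    then show ?thesis by (auto simp: left_null_space_def right_null_space_def mat_kernel_def rat_mat_def)
  qed
  then show ?thesis by (simp add: left_minimal_indices_def right_minimal_indices_def)
qed

section \<open>Dual minimal bases and their row degrees\<close>

lemma minimal_basis_rows:
  assumes "minimal_basis K" "K \<in> carrier_mat m n"
  shows "m < n" "free_list n (rows K)" "min_poly_basis n (sat_span n (rows K)) (rows K)"
proof -
  show "m < n" using assms by (auto simp: minimal_basis_def)
  have rows: "set (rows K) \<subseteq> carrier_vec n" using assms(2) rows_carrier[of K] by auto
  then have ws: "set (map rat_vec (rows K)) \<subseteq> carrier_vec n" by auto
  have "{u \<in> carrier_vec n. rat_vec u \<in> sat_span n (map rat_vec (rows K))} = sat_span n (rows K)"
    by (rule rat_vec_preimage_sat_span[OF rows])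
  then show min: "min_poly_basis n (sat_span n (rows K)) (rows K)"
    using assms rat_span_eq_sat_span[OF ws]
      minimal_basis_of_iff_min_poly_basis[OF saturated_sat_span, of n "map rat_vec (rows K)" "rows K"]
    by (simp add: minimal_basis_def)
  then show "free_list n (rows K)" by (simp add: min_poly_basis_def poly_basis_def)
qed

text \<open>Serves the convention for an empty block: a basis of constant vectors has degree sum 0
  and is therefore minimal.\<close>

lemma min_poly_basis_rows_one_mat: "min_poly_basis n (sat_span n (rows (1\<^sub>m n))) (rows (1\<^sub>m n))"
proof -
  have "c = 0\<^sub>v n" if "c \<in> carrier_vec n" "mat_of_cols n (rows (1\<^sub>m n)) *\<^sub>v c = 0\<^sub>v n"
    for c :: "'a poly vec"
    using that by (simp add: mat_of_cols_rows[OF one_carrier_mat])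
  then have "free_list n (rows (1\<^sub>m n :: 'a poly mat))" by (auto simp: free_list_def rows_def)
  moreover have "vec_degree v = 0" if "v \<in> set (rows (1\<^sub>m n :: 'a poly mat))" for v
  proof -
    have "vec_degree v \<le> 0" unfolding vec_degree_le_iff using that by (auto simp: rows_def)
    then show ?thesis by simp
  qed
  then have "sum_list (map vec_degree (rows (1\<^sub>m n :: 'a poly mat))) = 0" by (simp add: sum_list_eq_0_iff)
  ultimately show ?thesis unfolding min_poly_basis_def poly_basis_def by (metis le0)
qed

text \<open>Treats the empty and the nonempty block uniformly. In both cases the row counts add up
  to \<open>n\<close>, so the rows of each matrix span the kernel of the other; the second kernel
  uses the transposed relation.\<close>

lemma minimal_basis_dual_toD:
  assumes K: "minimal_basis K" "K \<in> carrier_mat m n" and N: "minimal_basis_dual_to K N"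
  obtains l where "N \<in> carrier_mat l n" "K * N\<^sup>T = 0\<^sub>m m l"
    "min_poly_basis n (mat_kernel K) (rows N)" "min_poly_basis n (mat_kernel N) (rows K)"
proof -
  define l where "l = dim_row N"
  note rK = minimal_basis_rows[OF K]
  have *: "N \<in> carrier_mat l n \<and> m + l = n \<and> K * N\<^sup>T = 0\<^sub>m m l \<and>
      min_poly_basis n (sat_span n (rows N)) (rows N)"
  proof (cases "m = 0")
    case True
    then have "N = 1\<^sub>m n" using N K(2) by (auto simp: minimal_basis_dual_to_def)
    then show ?thesis using True K(2) min_poly_basis_rows_one_mat by (auto simp: l_def)
  next
    case False
    then have "dual_minimal_bases K N" using N K(2) by (auto simp: minimal_basis_dual_to_def)
    then have *: "N \<in> carrier_mat l n" "m + l = n" "K * N\<^sup>T = 0\<^sub>m m l" "minimal_basis N"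
      using K(2) by (auto simp: dual_minimal_bases_def l_def)
    then show ?thesis using minimal_basis_rows(3)[of N l n] by blast
  qed
  then have free: "free_list n (rows N)" by (auto simp: min_poly_basis_def poly_basis_def)
  have "mat_kernel K = sat_span n (rows N)"
    using mat_kernel_eq_sat_span_rows[OF K(2) _ _ rK(2) free] * by blast
  moreover have "N * K\<^sup>T = 0\<^sub>m l m"
  proof -
    have "N * K\<^sup>T = (K * N\<^sup>T)\<^sup>T" using * K(2) by (subst transpose_mult[where n = n]) auto
    then show ?thesis using * by simp
  qed
  then have "mat_kernel N = sat_span n (rows K)"
    using mat_kernel_eq_sat_span_rows[OF _ K(2) _ free rK(2)] * by (metis add.commute)
  ultimately show thesis using that * rK(3) by metis
qed

lemma mat_degree_le_iff:
  "mat_degree P \<le> d \<longleftrightarrow> (\<forall>i<dim_row P. \<forall>j<dim_col P. degree (P $$ (i, j)) \<le> d)"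
  by (auto simp: mat_degree_def)

lemma mat_degree_eq_row_degree:
  assumes eq: "\<And>v w. v \<in> set (rows N) \<Longrightarrow> w \<in> set (rows N) \<Longrightarrow> vec_degree v = vec_degree w"
    and v: "v \<in> set (rows N)"
  shows "vec_degree v = mat_degree N"
proof (rule antisym)
  show "vec_degree v \<le> mat_degree N"
    using v mat_degree_le_iff[of N "mat_degree N"] by (auto simp: vec_degree_le_iff rows_def)
  have "degree (N $$ (i, j)) \<le> vec_degree v" if "i < dim_row N" "j < dim_col N" for i j
    using eq[OF v, of "row N i"] that degree_le_vec_degree[of j "row N i"] by (auto simp: rows_def)
  then show "mat_degree N \<le> vec_degree v" by (simp add: mat_degree_le_iff)
qed

text \<open>The definition provides equal row degrees for some dual \<open>N'\<close> only. Both
  \<open>N\<close> and \<open>N'\<close> have rows forming a minimal basis of the kernel of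
  \<open>K\<close>, so their row degrees agree.\<close>

lemma dual_row_degrees:
  assumes K: "strong_minimal_block K" "K \<in> carrier_mat m n" and N: "minimal_basis_dual_to K N"
    and v: "v \<in> set (rows N)"
  shows "vec_degree v = mat_degree N"
proof (rule mat_degree_eq_row_degree[OF _ v])
  have mK: "minimal_basis K" using K by (simp add: strong_minimal_block_def)
  obtain N' where N': "minimal_basis_dual_to K N'"
    "\<And>v w. v \<in> set (rows N') \<Longrightarrow> w \<in> set (rows N') \<Longrightarrow> vec_degree v = vec_degree w"
    using K by (auto simp: strong_minimal_block_def)
  have "mset (map vec_degree (rows N)) = mset (map vec_degree (rows N'))"
    using minimal_basis_dual_toD[OF mK K(2) N] minimal_basis_dual_toD[OF mK K(2) N'(1)]
      min_poly_basis_degrees_unique by metis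
  then have "set (map vec_degree (rows N)) = set (map vec_degree (rows N'))" by (rule mset_eq_setD)
  then have s: "vec_degree ` set (rows N) = vec_degree ` set (rows N')" by simp
  fix v w assume "v \<in> set (rows N)" "w \<in> set (rows N)"
  then have "vec_degree v \<in> vec_degree ` set (rows N')" "vec_degree w \<in> vec_degree ` set (rows N')"
    using s by blast+
  then show "vec_degree v = vec_degree w" using N'(2) by (metis imageE)
qed

text \<open>The upper bound holds termwise; the lower one is the absence of cancellation, applied at
  an entry of \<open>z\<close> of largest degree.\<close>

lemma min_poly_basis_uniform_degree:
  assumes min: "min_poly_basis n W vs" and d: "\<And>v. v \<in> set vs \<Longrightarrow> vec_degree v = d"
    and z: "z \<in> carrier_vec (length vs)" "z \<noteq> 0\<^sub>v (length vs)"
  shows "vec_degree (mat_of_cols n vs *\<^sub>v z) = vec_degree z + d"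
proof (rule antisym)
  have vs: "set vs \<subseteq> carrier_vec n" using min by (auto simp: min_poly_basis_def poly_basis_def free_list_def)
  show "vec_degree (mat_of_cols n vs *\<^sub>v z) \<le> vec_degree z + d"
    unfolding vec_degree_le_iff
  proof (intro allI impI)
    fix r assume "r < dim_vec (mat_of_cols n vs *\<^sub>v z)"
    then have r: "r < n" by simp
    have "degree (vs ! i $ r * z $ i) \<le> vec_degree z + d" if i: "i < length vs" for i
    proof -
      have "vs ! i \<in> carrier_vec n" using i vs by auto
      then have "degree (vs ! i $ r) \<le> d" using degree_le_vec_degree[of r "vs ! i"] d[of "vs ! i"] i r by simp
      moreover have "degree (z $ i) \<le> vec_degree z" using i z by (intro degree_le_vec_degree) auto
      ultimately show ?thesis using degree_mult_le[of "vs ! i $ r" "z $ i"] by linarith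
    qed
    then show "degree ((mat_of_cols n vs *\<^sub>v z) $ r) \<le> vec_degree z + d"
      using r z by (auto simp: mat_of_cols_mult_vec_index simp del: index_mult_mat_vec intro!: degree_sum_le)
  qed
  have *: "degree (z $ j) + d \<le> vec_degree (mat_of_cols n vs *\<^sub>v z)" if "j < length vs" "z $ j \<noteq> 0" for j
    using min_poly_basis_predictable_degree[OF min z(1) that] d[of "vs ! j"] that by simp
  show "vec_degree z + d \<le> vec_degree (mat_of_cols n vs *\<^sub>v z)"
  proof (cases "vec_degree z = 0")
    case True
    obtain j where "j < length vs" "z $ j \<noteq> 0" using z by (metis eq_vecI index_zero_vec carrier_vecD)
    then show ?thesis using * True by fastforce
  next
    case False
    then obtain j where j: "j < length vs" "degree (z $ j) = vec_degree z"
      using vec_degree_attained[of z] z(1) by auto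
    then have "z $ j \<noteq> 0" using False by auto
    then show ?thesis using *[OF j(1)] j(2) by simp
  qed
qed

lemma saturated_Int:
  assumes V: "saturated n V" and W: "saturated n W"
  shows "saturated n (V \<inter> W)"
  unfolding saturated_def
proof (intro conjI ballI allI impI)
  note V = V[unfolded saturated_def] and W = W[unfolded saturated_def]
  show "V \<inter> W \<subseteq> carrier_vec n" "0\<^sub>v n \<in> V \<inter> W" using V W by auto
  show "u + v \<in> V \<inter> W" if "u \<in> V \<inter> W" "v \<in> V \<inter> W" for u v
    using V W that by simp
  show "a \<cdot>\<^sub>v u \<in> V \<inter> W" if "u \<in> V \<inter> W" for a u
    using V W that by simp
  show "u \<in> V \<inter> W" if "u \<in> carrier_vec n" "q \<noteq> 0" "q \<cdot>\<^sub>v u \<in> V \<inter> W" for q u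
    using V W that by (metis IntD1 IntD2 IntI)
qed

lemma sort_map_add: "sort (map (\<lambda>e. e + d) xs) = map (\<lambda>e. e + d) (sort xs)" for xs :: "nat list"
proof (rule properties_for_sort)
  show "sorted (map (\<lambda>e. e + d) (sort xs))"
    unfolding sorted_map by (rule sorted_wrt_mono_rel[OF _ sorted_sort]) simp
qed simp

section \<open>Kernel and minimal indices of the block pencil\<close>

lemma mat_vec_degree_le:
  assumes M: "M \<in> carrier_mat m n" and deg: "\<And>i j. i < m \<Longrightarrow> j < n \<Longrightarrow> degree (M $$ (i, j)) \<le> d"
    and x: "x \<in> carrier_vec n"
  shows "vec_degree (M *\<^sub>v x) \<le> d + vec_degree x"
  unfolding vec_degree_le_iff
proof (intro allI impI)
  fix i assume "i < dim_vec (M *\<^sub>v x)"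
  then have i: "i < m" using M by simp
  have "degree (M $$ (i, j) * x $ j) \<le> d + vec_degree x" if "j < n" for j
    using deg[OF i that] degree_le_vec_degree[of j x] that x degree_mult_le[of "M $$ (i, j)" "x $ j"] by simp
  then show "degree ((M *\<^sub>v x) $ i) \<le> d + vec_degree x"
    using i M x by (auto simp: scalar_prod_def intro!: degree_sum_le)
qed

lemma right_minimal_indices_block_pencil:
  fixes M K1 K2 N1 N2 :: "'a::field poly mat"
  assumes M: "M \<in> carrier_mat n2 n1" and K1: "K1 \<in> carrier_mat m1 n1" and K2: "K2 \<in> carrier_mat m2 n2"
    and strong: "strong_minimal_block K1" "strong_minimal_block K2"
    and dual: "minimal_basis_dual_to K1 N1" "minimal_basis_dual_to K2 N2"
    and degM: "\<And>i j. i < n2 \<Longrightarrow> j < n1 \<Longrightarrow> degree (M $$ (i, j)) \<le> 1"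
  shows "right_minimal_indices (block_pencil M K1 K2)
    = map (\<lambda>e. e + mat_degree N1) (right_minimal_indices (N2 * M * N1\<^sup>T))"
proof -
  have mK: "minimal_basis K1" "minimal_basis K2" using strong by (auto simp: strong_minimal_block_def)
  obtain l1 where N1: "N1 \<in> carrier_mat l1 n1" and KN1: "K1 * N1\<^sup>T = 0\<^sub>m m1 l1"
    and min1: "min_poly_basis n1 (mat_kernel K1) (rows N1)"
    using minimal_basis_dual_toD[OF mK(1) K1 dual(1)] by metis
  obtain l2 where N2: "N2 \<in> carrier_mat l2 n2" and KN2: "K2 * N2\<^sup>T = 0\<^sub>m m2 l2"
    and min2: "min_poly_basis n2 (mat_kernel N2) (rows K2)"
    using minimal_basis_dual_toD[OF mK(2) K2 dual(2)] by metis
  define Q where "Q = N2 * M * N1\<^sup>T"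
  define L where "L = block_pencil M K1 K2"
  define X where "X = mat_kernel K1 \<inter> mat_kernel (N2 * M)"
  have N1t: "N1\<^sup>T \<in> carrier_mat n1 l1" and K2t: "K2\<^sup>T \<in> carrier_mat n2 m2" using N1 K2 by auto
  have NM: "N2 * M \<in> carrier_mat l2 n1" and Q: "Q \<in> carrier_mat l2 l1" using N1 N2 M by (auto simp: Q_def)
  have L: "L \<in> carrier_mat (n2 + m1) (n1 + m2)" using M K1 K2 by (auto simp: L_def block_pencil_def)
  have X: "saturated n1 X" unfolding X_def by (intro saturated_Int saturated_mat_kernel[OF K1] saturated_mat_kernel[OF NM])
  have cols1: "mat_of_cols n1 (rows N1) = N1\<^sup>T" "length (rows N1) = l1" using N1 by (auto simp: mat_of_cols_rows)
  have cols2: "mat_of_cols n2 (rows K2) = K2\<^sup>T" "length (rows K2) = m2" using K2 by (auto simp: mat_of_cols_rows)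
  have inj1: "z = 0\<^sub>v l1" if "z \<in> carrier_vec l1" "N1\<^sup>T *\<^sub>v z = 0\<^sub>v n1" for z
    using min1 that cols1 by (auto simp: min_poly_basis_def poly_basis_def free_list_def)
  have inj2: "y = 0\<^sub>v m2" if "y \<in> carrier_vec m2" "K2\<^sup>T *\<^sub>v y = 0\<^sub>v n2" for y
    using min2 that cols2 by (auto simp: min_poly_basis_def poly_basis_def free_list_def)

  have Qz: "Q *\<^sub>v z = N2 * M *\<^sub>v (N1\<^sup>T *\<^sub>v z)" if "z \<in> carrier_vec l1" for z
    unfolding Q_def using that by (intro assoc_mult_mat_vec[OF NM N1t])
  have K1z: "K1 *\<^sub>v (N1\<^sup>T *\<^sub>v z) = 0\<^sub>v m1" if "z \<in> carrier_vec l1" for z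
    unfolding assoc_mult_mat_vec[OF K1 N1t that, symmetric] KN1 using that by (intro eq_vecI) auto
  have img1: "(*\<^sub>v) N1\<^sup>T ` mat_kernel Q = X"
  proof (intro subset_antisym subsetI)
    fix x assume "x \<in> (*\<^sub>v) N1\<^sup>T ` mat_kernel Q"
    then show "x \<in> X" using Qz K1z N1t
      by (auto simp: X_def mat_kernel[OF Q] mat_kernel[OF K1] mat_kernel[OF NM])
  next
    fix x assume x: "x \<in> X"
    then have "x \<in> mat_kernel K1" by (simp add: X_def)
    \<comment> \<open>Minimality of \<open>N1\<close> makes the preimage \<open>z\<close>
      polynomial, not merely rational.\<close>
    from min_poly_basis_integral[OF min1 this] obtain z where
      z: "z \<in> carrier_vec l1" "x = N1\<^sup>T *\<^sub>v z" unfolding cols1 .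
    then have "z \<in> mat_kernel Q" using x Qz[OF z(1)] by (auto simp: X_def mat_kernel[OF Q] mat_kernel[OF NM])
    then show "x \<in> (*\<^sub>v) N1\<^sup>T ` mat_kernel Q" using z by blast
  qed
  have shift1: "vec_degree (N1\<^sup>T *\<^sub>v z) = vec_degree z + mat_degree N1"
    if "z \<in> mat_kernel Q" "z \<noteq> 0\<^sub>v l1" for z
    using min_poly_basis_uniform_degree[OF min1 dual_row_degrees[OF strong(1) K1 dual(1)], of z] that
    unfolding cols1 by (auto simp: mat_kernel[OF Q])
  obtain vs where vs: "min_poly_basis l1 (mat_kernel Q) vs"
    using min_poly_basis_exists[OF saturated_mat_kernel[OF Q]] .
  have X_vs: "min_poly_basis n1 X (map ((*\<^sub>v) N1\<^sup>T) vs)"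
    using min_poly_basis_image[OF N1t saturated_mat_kernel[OF Q] X img1 inj1 shift1 vs]
    by (auto simp: mat_kernel[OF Q])
  have deg_vs: "map vec_degree (map ((*\<^sub>v) N1\<^sup>T) vs) = map (\<lambda>e. e + mat_degree N1) (map vec_degree vs)"
    using poly_basis_image_degrees[OF N1t saturated_mat_kernel[OF Q] X img1 inj1 shift1, of vs] vs
    by (auto simp: mat_kernel[OF Q] min_poly_basis_def)

  \<comment> \<open>The matrix of the projection of \<open>x @\<^sub>v y\<close> to
    \<open>x\<close>.\<close>
  define T where "T = mat n1 (n1 + m2) (\<lambda>(i, j). if i = j then 1 else 0 :: 'a poly)"
  have T: "T \<in> carrier_mat n1 (n1 + m2)" by (simp add: T_def)
  have Tv: "T *\<^sub>v (x @\<^sub>v y) = x" if "x \<in> carrier_vec n1" "y \<in> carrier_vec m2" for x y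
  proof (intro eq_vecI)
    fix i assume "i < dim_vec x"
    then have i: "i < n1" using that by simp
    define v where "v = x @\<^sub>v y"
    have v: "dim_vec v = n1 + m2" "v $ i = x $ i" using i that by (auto simp: v_def)
    have "(T *\<^sub>v v) $ i = (\<Sum>j\<in>{0..<n1 + m2}. (if i = j then 1 else 0) * v $ j)"
      using i v(1) by (simp add: T_def scalar_prod_def)
    also have "\<dots> = (\<Sum>j\<in>{0..<n1 + m2}. if i = j then v $ j else 0)" by (rule sum.cong) auto
    also have "\<dots> = x $ i" using i v(2) by simp
    finally show "(T *\<^sub>v (x @\<^sub>v y)) $ i = x $ i" unfolding v_def .
  qed (use that in \<open>simp add: T_def\<close>)
  have split: "\<exists>x y. v = x @\<^sub>v y \<and> x \<in> carrier_vec n1 \<and> y \<in> carrier_vec m2"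
    if "v \<in> carrier_vec (n1 + m2)" for v :: "'a poly vec"
    using vec_first_last_append[OF that] by (metis vec_first_carrier vec_last_carrier)
  have ker_L: "x @\<^sub>v y \<in> mat_kernel L \<longleftrightarrow> M *\<^sub>v x + K2\<^sup>T *\<^sub>v y = 0\<^sub>v n2 \<and> K1 *\<^sub>v x = 0\<^sub>v m1"
    if x: "x \<in> carrier_vec n1" and y: "y \<in> carrier_vec m2" for x y
  proof -
    have D: "0\<^sub>m (dim_row K1) (dim_row K2) \<in> carrier_mat m1 m2" using K1 K2 by auto
    have "K1 *\<^sub>v x + 0\<^sub>m m1 m2 *\<^sub>v y = K1 *\<^sub>v x" using K1 x y by (intro eq_vecI) auto
    then have "L *\<^sub>v (x @\<^sub>v y) = (M *\<^sub>v x + K2\<^sup>T *\<^sub>v y) @\<^sub>v (K1 *\<^sub>v x)"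
      unfolding L_def block_pencil_def using four_block_mat_mult_vec[OF M K2t K1 D x y] K1 K2 by simp
    moreover have "0\<^sub>v (n2 + m1) = (0\<^sub>v n2 @\<^sub>v 0\<^sub>v m1 :: 'a poly vec)" by (intro eq_vecI) auto
    moreover have "M *\<^sub>v x + K2\<^sup>T *\<^sub>v y \<in> carrier_vec n2" using M K2t x y by auto
    ultimately show ?thesis using x y by (simp add: mat_kernel[OF L] append_vec_eq)
  qed
  have NKy: "N2 *\<^sub>v (K2\<^sup>T *\<^sub>v y) = 0\<^sub>v l2" if "y \<in> carrier_vec m2" for y
  proof -
    have "N2 * K2\<^sup>T = (K2 * N2\<^sup>T)\<^sup>T" using N2 K2 by (subst transpose_mult[where n = n2]) auto
    then have "N2 * K2\<^sup>T = 0\<^sub>m l2 m2" using KN2 by simp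
    then show ?thesis
      unfolding assoc_mult_mat_vec[OF N2 K2t that, symmetric] using that by (intro eq_vecI) auto
  qed
  have neg: "K2\<^sup>T *\<^sub>v y = - (M *\<^sub>v x)"
    if "M *\<^sub>v x + K2\<^sup>T *\<^sub>v y = 0\<^sub>v n2" "x \<in> carrier_vec n1" "y \<in> carrier_vec m2" for x y
    using that M K2t by (auto simp: vec_eq_iff add_eq_0_iff simp del: index_mult_mat_vec)
  have img2: "(*\<^sub>v) T ` mat_kernel L = X"
  proof (intro subset_antisym subsetI)
    fix x assume "x \<in> (*\<^sub>v) T ` mat_kernel L"
    then obtain v where v: "v \<in> mat_kernel L" "x = T *\<^sub>v v" by auto
    then obtain x' y where xy: "v = x' @\<^sub>v y" "x' \<in> carrier_vec n1" "y \<in> carrier_vec m2"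
      using split[OF mat_kernelD(1)[OF L v(1)]] by blast
    have x': "x' = x" using v xy Tv by simp
    have e: "M *\<^sub>v x + K2\<^sup>T *\<^sub>v y = 0\<^sub>v n2" "K1 *\<^sub>v x = 0\<^sub>v m1" using ker_L[OF xy(2,3)] v(1) unfolding xy(1) x' by auto
    have xn: "x \<in> carrier_vec n1" using xy x' by simp
    \<comment> \<open>Multiplying the first block equation by \<open>N2\<close> eliminates
      \<open>y\<close>.\<close>
    have "0\<^sub>v l2 = N2 *\<^sub>v (M *\<^sub>v x + K2\<^sup>T *\<^sub>v y)" using e(1) N2 mult_mat_vec_zero[of N2] by simp
    also have "\<dots> = N2 *\<^sub>v (M *\<^sub>v x) + 0\<^sub>v l2"
      using M K2t xn xy(3) by (simp add: mult_add_distrib_mat_vec[OF N2] NKy)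
    also have "\<dots> = N2 * M *\<^sub>v x" using N2 M xn by simp
    finally show "x \<in> X" using e(2) xn by (simp add: X_def mat_kernel[OF K1] mat_kernel[OF NM])
  next
    fix x assume x: "x \<in> X"
    then have xn: "x \<in> carrier_vec n1" "K1 *\<^sub>v x = 0\<^sub>v m1" "N2 * M *\<^sub>v x = 0\<^sub>v l2"
      by (auto simp: X_def mat_kernel[OF K1] mat_kernel[OF NM])
    then have "M *\<^sub>v x \<in> mat_kernel N2" using N2 M by (auto simp: mat_kernel[OF N2])
    \<comment> \<open>The rows of \<open>K2\<close> are a minimal basis of the kernel of
      \<open>N2\<close>, so \<open>M *\<^sub>v x\<close> is a polynomial combination of them; its
      negated coefficients complete \<open>x\<close> to a kernel vector of \<open>L\<close>.\<close>
    from min_poly_basis_integral[OF min2 this] obtain y where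
      y: "y \<in> carrier_vec m2" "M *\<^sub>v x = K2\<^sup>T *\<^sub>v y" unfolding cols2 .
    have "K2\<^sup>T *\<^sub>v ((- 1) \<cdot>\<^sub>v y) = (- 1) \<cdot>\<^sub>v (K2\<^sup>T *\<^sub>v y)" by (rule mat_vec_smult[OF K2t y(1)])
    then have "M *\<^sub>v x + K2\<^sup>T *\<^sub>v ((- 1) \<cdot>\<^sub>v y) = 0\<^sub>v n2"
      unfolding y(2) using K2t by (auto simp: vec_eq_iff simp del: index_mult_mat_vec)
    then have "x @\<^sub>v ((- 1) \<cdot>\<^sub>v y) \<in> mat_kernel L" using ker_L[OF xn(1), of "(- 1) \<cdot>\<^sub>v y"] y xn by simp
    moreover have "T *\<^sub>v (x @\<^sub>v ((- 1) \<cdot>\<^sub>v y)) = x" using Tv[OF xn(1), of "(- 1) \<cdot>\<^sub>v y"] y by simp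
    ultimately show "x \<in> (*\<^sub>v) T ` mat_kernel L" by (metis image_eqI)
  qed
  have inj3: "v = 0\<^sub>v (n1 + m2)" if v: "v \<in> mat_kernel L" "T *\<^sub>v v = 0\<^sub>v n1" for v
  proof -
    obtain x y where xy: "v = x @\<^sub>v y" "x \<in> carrier_vec n1" "y \<in> carrier_vec m2"
      using split[OF mat_kernelD(1)[OF L v(1)]] by blast
    have x: "x = 0\<^sub>v n1" using v(2) xy Tv by simp
    have "K2\<^sup>T *\<^sub>v y = - (M *\<^sub>v x)" using ker_L[OF xy(2,3)] v xy by (intro neg) auto
    also have "M *\<^sub>v x = 0\<^sub>v n2" using x M mult_mat_vec_zero[of M] by simp
    finally have "y = 0\<^sub>v m2" using xy(3) by (intro inj2) auto
    then show ?thesis using x xy(1) by (auto intro!: eq_vecI)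
  qed
  have shift3: "vec_degree (T *\<^sub>v v) = vec_degree v + 0" if v: "v \<in> mat_kernel L" "v \<noteq> 0\<^sub>v (n1 + m2)" for v
  proof -
    obtain x y where xy: "v = x @\<^sub>v y" "x \<in> carrier_vec n1" "y \<in> carrier_vec m2"
      using split[OF mat_kernelD(1)[OF L v(1)]] by blast
    have y_le: "vec_degree y \<le> vec_degree x"
    proof (cases "y = 0\<^sub>v m2")
      case True
      then show ?thesis by (simp add: vec_degree_le_iff)
    next
      case False
      \<comment> \<open>All rows of \<open>K2\<close> have degree exactly 1, so \<open>K2\<close>
        raises the degree of a nonzero \<open>y\<close> by 1, while \<open>M\<close> raises that of
        \<open>x\<close> by at most 1.\<close>
      have "vec_degree y + 1 = vec_degree (K2\<^sup>T *\<^sub>v y)"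
        using min_poly_basis_uniform_degree[OF min2, of 1 y] strong(2) xy(3) False
        unfolding cols2 by (auto simp: strong_minimal_block_def)
      also have "K2\<^sup>T *\<^sub>v y = - (M *\<^sub>v x)" using ker_L[OF xy(2,3)] v xy by (intro neg) auto
      also have "vec_degree (- (M *\<^sub>v x)) = vec_degree (M *\<^sub>v x)"
        by (auto simp: vec_degree_def intro!: arg_cong[where f = Max] image_cong simp del: index_mult_mat_vec)
      also have "\<dots> \<le> 1 + vec_degree x" by (rule mat_vec_degree_le[OF M degM xy(2)])
      finally show ?thesis by simp
    qed
    have "vec_degree v = vec_degree x"
    proof (rule antisym)
      show "vec_degree v \<le> vec_degree x" unfolding vec_degree_le_iff
      proof (intro allI impI)
        fix i assume "i < dim_vec v"
        then show "degree (v $ i) \<le> vec_degree x"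
          using xy y_le degree_le_vec_degree[of i x] degree_le_vec_degree[of "i - n1" y]
          by (cases "i < n1") (auto intro: order_trans simp: less_diff_conv2)
      qed
      show "vec_degree x \<le> vec_degree v" unfolding vec_degree_le_iff
      proof (intro allI impI)
        fix i assume "i < dim_vec x"
        then show "degree (x $ i) \<le> vec_degree v"
          using xy degree_le_vec_degree[of i v] by auto
      qed
    qed
    then show ?thesis using xy Tv by simp
  qed
  obtain us where us: "min_poly_basis (n1 + m2) (mat_kernel L) us"
    using min_poly_basis_exists[OF saturated_mat_kernel[OF L]] .
  have X_us: "min_poly_basis n1 X (map ((*\<^sub>v) T) us)"
    by (rule min_poly_basis_image[OF T saturated_mat_kernel[OF L] X img2 inj3 shift3 us])
  have deg_us: "map vec_degree (map ((*\<^sub>v) T) us) = map vec_degree us"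
    using poly_basis_image_degrees[OF T saturated_mat_kernel[OF L] X img2 inj3 shift3, of us] us
    by (simp add: min_poly_basis_def)
  \<comment> \<open>The images of \<open>us\<close> and \<open>vs\<close> are two minimal bases of
    the same module \<open>X\<close>.\<close>
  have "mset (map vec_degree us) = mset (map (\<lambda>e. e + mat_degree N1) (map vec_degree vs))"
    using min_poly_basis_degrees_unique[OF X_us X_vs] unfolding deg_us deg_vs .
  then have "sort (map vec_degree us) = sort (map (\<lambda>e. e + mat_degree N1) (map vec_degree vs))"
    by (metis sorted_list_of_multiset_mset)
  then show ?thesis
    unfolding Q_def[symmetric] L_def[symmetric] right_minimal_indices_eq[OF L us] right_minimal_indices_eq[OF Q vs]
      sort_map_add .
qed

lemma matrix_pencil_degree:
  assumes "matrix_pencil P" "i < dim_row P" "j < dim_col P"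
  shows "degree (P $$ (i, j)) \<le> 1"
proof -
  obtain A B where A: "A \<in> carrier_mat (dim_row P) (dim_col P)" and B: "B \<in> carrier_mat (dim_row P) (dim_col P)"
    and P: "P = map_mat (\<lambda>a. [:a:]) A + [:0, 1:] \<cdot>\<^sub>m map_mat (\<lambda>b. [:b:]) B"
    using assms(1) unfolding matrix_pencil_def by blast
  have "P $$ (i, j) = [:A $$ (i, j), B $$ (i, j):]" by (subst P) (use A B assms in simp)
  then show ?thesis by simp
qed

theorem theorem3p6:
  fixes M K1 K2 N1 N2 L Q :: "'a::field poly mat"
  assumes "strong_block_minimal_bases_pencil M K1 K2"
    and "L = block_pencil M K1 K2"
    and "minimal_basis_dual_to K1 N1"
    and "minimal_basis_dual_to K2 N2"
    and "Q = N2 * M * N1\<^sup>T"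
  shows "right_minimal_indices L = map (\<lambda>\<epsilon>. \<epsilon> + mat_degree N1) (right_minimal_indices Q) \<and>
         left_minimal_indices L = map (\<lambda>\<eta>. \<eta> + mat_degree N2) (left_minimal_indices Q)"
proof -
  define n1 n2 m1 m2 where "n1 = dim_col M" and "n2 = dim_row M" and "m1 = dim_row K1" and "m2 = dim_row K2"
  note S = assms(1)[unfolded strong_block_minimal_bases_pencil_def]
  have strong: "strong_minimal_block K1" "strong_minimal_block K2" using S by auto
  have M: "M \<in> carrier_mat n2 n1" and K1: "K1 \<in> carrier_mat m1 n1" and K2: "K2 \<in> carrier_mat m2 n2"
    using S by (auto simp: n1_def n2_def m1_def m2_def)
  have degM: "degree (M $$ (i, j)) \<le> 1" if "i < n2" "j < n1" for i j
    using S matrix_pencil_degree[of "block_pencil M K1 K2" i j] that M K1 K2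
    by (auto simp: block_pencil_def)
  have mK: "minimal_basis K1" "minimal_basis K2" using strong by (auto simp: strong_minimal_block_def)
  obtain l1 l2 where N1: "N1 \<in> carrier_mat l1 n1" and N2: "N2 \<in> carrier_mat l2 n2"
    using minimal_basis_dual_toD[OF mK(1) K1 assms(3)] minimal_basis_dual_toD[OF mK(2) K2 assms(4)] by metis
  have Mt: "M\<^sup>T \<in> carrier_mat n1 n2" using M by simp
  \<comment> \<open>Transposition exchanges \<open>K1\<close> with \<open>K2\<close> and
    \<open>N1\<close> with \<open>N2\<close>, so the statement on left indices is the one on right
    indices for the transposed pencil.\<close>
  have "L\<^sup>T = block_pencil M\<^sup>T K2 K1"
    unfolding assms(2) block_pencil_def using M K1 K2
    by (subst transpose_four_block_mat[of _ n2 n1 _ m2 _ m1]) auto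
  moreover have "Q\<^sup>T = N1 * M\<^sup>T * N2\<^sup>T"
  proof -
    have "Q\<^sup>T = N1 * (N2 * M)\<^sup>T"
      unfolding assms(5) using N1 N2 M by (subst transpose_mult[where n = n1]) auto
    also have "(N2 * M)\<^sup>T = M\<^sup>T * N2\<^sup>T" using N2 M by (subst transpose_mult[where n = n2]) auto
    also have "N1 * (M\<^sup>T * N2\<^sup>T) = N1 * M\<^sup>T * N2\<^sup>T" 
      using N1 N2 M by (intro assoc_mult_mat[symmetric]) auto
    finally show ?thesis .
  qed
  moreover have "degree (M\<^sup>T $$ (i, j)) \<le> 1" if "i < n1" "j < n2" for i j
    using degM[of j i] that M by simp
  ultimately have "left_minimal_indices L = map (\<lambda>\<eta>. \<eta> + mat_degree N2) (left_minimal_indices Q)"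
    using right_minimal_indices_block_pencil[OF Mt K2 K1 strong(2,1) assms(4,3)]
    by (simp add: left_minimal_indices_transpose)
  then show ?thesis
    using right_minimal_indices_block_pencil[OF M K1 K2 strong assms(3,4) degM] assms(2,5) by simp
qed

end
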